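(* Let $\mathbb{K}$ be a field with $\operatorname{char}(\mathbb{K})=0$, let $G$ be a finite group acting on a nonempty set $E$, and let $D=G\times E$ be the associated generalized digroup. If there exist objects $Q,W\in\mathsf{Rep}(D)$ such that $$\operatorname{Ext}^1_{B_E}(Q,W)^G\neq 0,$$ then the category $\mathsf{Rep}(D)$ is not semisimple.
   Context: Let $G$ be a group with identity $1$ acting on the left on a nonempty set $E$, $(g,\alpha)\mapsto g\bullet\alpha$. The associated generalized digroup is $D=G\times E$ with operations $(g,\alpha)\vdash(h,\beta)=(gh,g\bullet\beta)$, $(g,\alpha)\dashv(h,\beta)=(gh,\alpha)$ and halo $\overline{E}=\{(1,\alpha)\mid\alpha\in E\}$. (Every generalized digroup is isomorphic to one of this form.) A representation of $D$ over $\mathbb{K}$ is a triple $(V,\lambda,\rho)$ where $V$ is a $\mathbb{K}$-vector space and $\lambda:D\to\operatorname{End}(V)$, $\rho:D\to\operatorname{Aut}(V)$ are maps such that for all $x,y\in D$ and $e\in\overline{E}$: $\lambda_{x\dashv y}=\lambda_x\lambda_y$, $\rho_{x\vdash y}=\rho_x\rho_y$, $\rho_e=\mathrm{id}_V$, $\rho_x\lambda_y=\lambda_{x\vdash y}$, $\lambda_x\rho_y=\lambda_{x\dashv y}$. A morphism of representations is a $\mathbb{K}$-linear map commuting with all $\lambda_x$ and $\rho_x$. These form the category $\mathsf{Rep}(D)$, which is abelian with enough injectives; it is semisimple if every short exact sequence in it splits. For any representation, $\rho_{(g,\alpha)}$ depends only on $g$, is written $\rho_g$, and $g\mapsto\rho_g$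 is a representation of $G$. The halo algebra $B_E$ is the unital associative $\mathbb{K}$-algebra generated by symbols $\varepsilon_\alpha$ ($\alpha\in E$) subject to $\varepsilon_\alpha\varepsilon_\beta=\varepsilon_\alpha$ for all $\alpha,\beta\in E$. Every representation $(V,\lambda,\rho)$ is a left $B_E$-module via $\varepsilon_\alpha\cdot v=\lambda_{(1,\alpha)}(v)$. The group $G$ acts on $\operatorname{Hom}_{B_E}(Q,W)$ by $(g\cdot f)(q)=\rho_g^W(f((\rho_g^Q)^{-1}(q)))$. The $G$-module structure on $\operatorname{Ext}^1_{B_E}(Q,W)$ is the one induced by this action on the complex $\operatorname{Hom}_{B_E}(Q,I^\bullet)$, where $W\to I^\bullet$ is an injective resolution in $\mathsf{Rep}(D)$, whose underlying complex of $B_E$-modules is an injective resolution of $W$ in $B_E\text{-}\mathsf{Mod}$. The superscript $G$ denotes $G$-invariants. *)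

theory Defs
  imports "HOL-Algebra.Group_Action" "HOL-Algebra.Module" "HOL-Algebra.QuotRing"
begin

section \<open>Generalized digroups and their representations\<close>

record 'd digroup = "'d partial_object" +
  lprod :: "'d \<Rightarrow> 'd \<Rightarrow> 'd" (infixl \<open>\<turnstile>\<index>\<close> 70)
  rprod :: "'d \<Rightarrow> 'd \<Rightarrow> 'd" (infixl \<open>\<stileturn>\<index>\<close> 70)
  halo :: "'d set"

definition action_digroup ::
    "('g, 'm) monoid_scheme \<Rightarrow> 'e set \<Rightarrow> ('g \<Rightarrow> 'e \<Rightarrow> 'e) \<Rightarrow> ('g \<times> 'e) digroup"
  where "action_digroup G E \<phi> =
    \<lparr>carrier = carrier G \<times> E,
     lprod = (\<lambda>(g, \<alpha>) (h, \<beta>). (g \<otimes>\<^bsub>G\<^esub> h, \<phi> g \<beta>)),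
     rprod = (\<lambda>(g, \<alpha>) (h, \<beta>). (g \<otimes>\<^bsub>G\<^esub> h, \<alpha>)),
     halo = {\<one>\<^bsub>G\<^esub>} \<times> E\<rparr>"

text \<open>The ring fields \<open>mult\<close> and \<open>one\<close> that a representation inherits from the record
  \<open>module\<close> carry no information.\<close>

record ('k, 'v, 'd) rep = "('k, 'v) module" +
  lam :: "'d \<Rightarrow> 'v \<Rightarrow> 'v"
  rho :: "'d \<Rightarrow> 'v \<Rightarrow> 'v"

definition linear_maps ::
    "('k, 'm) ring_scheme \<Rightarrow> ('k, 'v, 'a) module_scheme \<Rightarrow> ('k, 'w, 'b) module_scheme
      \<Rightarrow> ('v \<Rightarrow> 'w) set"
  where "linear_maps K V W =
    {f \<in> carrier V \<rightarrow> carrier W.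
      (\<forall>u\<in>carrier V. \<forall>v\<in>carrier V. f (u \<oplus>\<^bsub>V\<^esub> v) = f u \<oplus>\<^bsub>W\<^esub> f v) \<and>
      (\<forall>c\<in>carrier K. \<forall>v\<in>carrier V. f (c \<odot>\<^bsub>V\<^esub> v) = c \<odot>\<^bsub>W\<^esub> f v)}"

text \<open>A representation is carried by a subset of the type \<open>'v\<close>, which thus plays the role of
  the universe in which the category \<open>Rep(D)\<close> is formed. All notions below that quantify over
  objects of \<open>Rep(D)\<close> refer to this universe.\<close>

definition is_rep ::
    "('k, 'm) ring_scheme \<Rightarrow> ('d, 'n) digroup_scheme \<Rightarrow> ('k, 'v, 'd) rep \<Rightarrow> bool"
  where "is_rep K D V \<longleftrightarrow>
    module K V \<and>
    (\<forall>x\<in>carrier D. lam V x \<in> linear_maps K V V) \<and>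
    (\<forall>x\<in>carrier D. rho V x \<in> linear_maps K V V \<and> bij_betw (rho V x) (carrier V) (carrier V)) \<and>
    (\<forall>x\<in>carrier D. \<forall>y\<in>carrier D. \<forall>v\<in>carrier V.
      lam V (x \<stileturn>\<^bsub>D\<^esub> y) v = lam V x (lam V y v) \<and>
      rho V (x \<turnstile>\<^bsub>D\<^esub> y) v = rho V x (rho V y v) \<and>
      rho V x (lam V y v) = lam V (x \<turnstile>\<^bsub>D\<^esub> y) v \<and>
      lam V x (rho V y v) = lam V (x \<stileturn>\<^bsub>D\<^esub> y) v) \<and>
    (\<forall>e\<in>halo D. \<forall>v\<in>carrier V. rho V e v = v)"

definition rep_morphisms ::
    "('k, 'm) ring_scheme \<Rightarrow> ('d, 'n) digroup_scheme \<Rightarrow> ('k, 'v, 'd) rep \<Rightarrow> ('k, 'w, 'd) rep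
      \<Rightarrow> ('v \<Rightarrow> 'w) set"
  where "rep_morphisms K D V W =
    {f \<in> linear_maps K V W. \<forall>x\<in>carrier D. \<forall>v\<in>carrier V.
      f (lam V x v) = lam W x (f v) \<and> f (rho V x v) = rho W x (f v)}"

definition exact_at :: "('k, 'u, 'd) rep \<Rightarrow> ('u \<Rightarrow> 'v) \<Rightarrow> ('k, 'v, 'd) rep \<Rightarrow> ('v \<Rightarrow> 'w)
      \<Rightarrow> ('k, 'w, 'd) rep \<Rightarrow> bool"
  where "exact_at A f B g C \<longleftrightarrow> f ` carrier A = {b \<in> carrier B. g b = \<zero>\<^bsub>C\<^esub>}"

definition short_exact ::
    "('k, 'm) ring_scheme \<Rightarrow> ('d, 'n) digroup_scheme \<Rightarrow> ('k, 'v, 'd) rep \<Rightarrow> ('v \<Rightarrow> 'v)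
      \<Rightarrow> ('k, 'v, 'd) rep \<Rightarrow> ('v \<Rightarrow> 'v) \<Rightarrow> ('k, 'v, 'd) rep \<Rightarrow> bool"
  where "short_exact K D A i B p C \<longleftrightarrow>
    is_rep K D A \<and> is_rep K D B \<and> is_rep K D C \<and>
    i \<in> rep_morphisms K D A B \<and> p \<in> rep_morphisms K D B C \<and>
    inj_on i (carrier A) \<and> exact_at A i B p C \<and> p ` carrier B = carrier C"

definition semisimple_Rep ::
    "('k, 'm) ring_scheme \<Rightarrow> ('d, 'n) digroup_scheme \<Rightarrow> 'v itself \<Rightarrow> bool"
  where "semisimple_Rep K D U \<longleftrightarrow>
    (\<forall>(A :: ('k, 'v, 'd) rep) i B p C. short_exact K D A i B p C \<longrightarrow>
      (\<exists>s \<in> rep_morphisms K D C B. \<forall>c\<in>carrier C. p (s c) = c))"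

definition injective_rep ::
    "('k, 'm) ring_scheme \<Rightarrow> ('d, 'n) digroup_scheme \<Rightarrow> ('k, 'v, 'd) rep \<Rightarrow> bool"
  where "injective_rep K D I \<longleftrightarrow> is_rep K D I \<and>
    (\<forall>(A :: ('k, 'v, 'd) rep) (B :: ('k, 'v, 'd) rep) i f. is_rep K D A \<and> is_rep K D B \<and>
      i \<in> rep_morphisms K D A B \<and> inj_on i (carrier A) \<and> f \<in> rep_morphisms K D A I \<longrightarrow>
      (\<exists>h \<in> rep_morphisms K D B I. \<forall>a\<in>carrier A. h (i a) = f a))"

text \<open>An injective resolution \<open>0 \<rightarrow> W \<rightarrow> I 0 \<rightarrow> I 1 \<rightarrow> \<dots>\<close> in \<open>Rep(D)\<close>, with augmentation \<open>\<eta>\<close> and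
  differentials \<open>d n : I n \<rightarrow> I (n + 1)\<close>.\<close>

definition injective_resolution ::
    "('k, 'm) ring_scheme \<Rightarrow> ('d, 'n) digroup_scheme \<Rightarrow> ('k, 'v, 'd) rep \<Rightarrow> ('v \<Rightarrow> 'v)
      \<Rightarrow> (nat \<Rightarrow> ('k, 'v, 'd) rep) \<Rightarrow> (nat \<Rightarrow> 'v \<Rightarrow> 'v) \<Rightarrow> bool"
  where "injective_resolution K D W \<eta> I d \<longleftrightarrow>
    is_rep K D W \<and> (\<forall>n. injective_rep K D (I n)) \<and>
    \<eta> \<in> rep_morphisms K D W (I 0) \<and> (\<forall>n. d n \<in> rep_morphisms K D (I n) (I (Suc n))) \<and>
    inj_on \<eta> (carrier W) \<and> exact_at W \<eta> (I 0) (d 0) (I 1) \<and>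
    (\<forall>n. exact_at (I n) (d n) (I (Suc n)) (d (Suc n)) (I (Suc (Suc n))))"


section \<open>The halo algebra\<close>

text \<open>Elements of the free unital associative algebra on the set \<open>E\<close> are finitely supported
  coefficient functions on the words over \<open>E\<close>; words multiply by concatenation.\<close>

definition word :: "('k, 'm) ring_scheme \<Rightarrow> 'e list \<Rightarrow> 'e list \<Rightarrow> 'k"
  where "word K w = (\<lambda>u. if u = w then \<one>\<^bsub>K\<^esub> else \<zero>\<^bsub>K\<^esub>)"

definition free_algebra :: "('k, 'm) ring_scheme \<Rightarrow> 'e set \<Rightarrow> ('e list \<Rightarrow> 'k) ring"
  where "free_algebra K E =
    \<lparr>carrier = {p. (\<forall>w. p w \<in> carrier K) \<and> finite {w. p w \<noteq> \<zero>\<^bsub>K\<^esub>} \<and>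
                   {w. p w \<noteq> \<zero>\<^bsub>K\<^esub>} \<subseteq> lists E},
     mult = (\<lambda>p q w. \<Oplus>\<^bsub>K\<^esub>i\<in>{..length w}. p (take i w) \<otimes>\<^bsub>K\<^esub> q (drop i w)),
     one = word K [],
     zero = (\<lambda>w. \<zero>\<^bsub>K\<^esub>),
     add = (\<lambda>p q w. p w \<oplus>\<^bsub>K\<^esub> q w)\<rparr>"

definition halo_ideal :: "('k, 'm) ring_scheme \<Rightarrow> 'e set \<Rightarrow> ('e list \<Rightarrow> 'k) set"
  where "halo_ideal K E = Idl\<^bsub>free_algebra K E\<^esub>
    {word K [\<alpha>] \<otimes>\<^bsub>free_algebra K E\<^esub> word K [\<beta>] \<ominus>\<^bsub>free_algebra K E\<^esub> word K [\<alpha>] |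
      \<alpha> \<beta>. \<alpha> \<in> E \<and> \<beta> \<in> E}"

definition halo_algebra :: "('k, 'm) ring_scheme \<Rightarrow> 'e set \<Rightarrow> ('e list \<Rightarrow> 'k) set ring"
  where "halo_algebra K E = free_algebra K E Quot halo_ideal K E"

text \<open>The action of the free algebra on a representation determined by
  \<open>\<epsilon>\<^sub>\<alpha> \<cdot> v = \<lambda>\<^bsub>(1, \<alpha>)\<^esub> v\<close>, and the induced action of the quotient. An element \<open>b\<close> of the
  halo algebra is a coset, all of whose members act in the same way.\<close>

definition free_act ::
    "('k, 'm) ring_scheme \<Rightarrow> ('g, 'n) monoid_scheme \<Rightarrow> ('k, 'v, 'g \<times> 'e) rep
      \<Rightarrow> ('e list \<Rightarrow> 'k) \<Rightarrow> 'v \<Rightarrow> 'v"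
  where "free_act K G V p v =
    (\<Oplus>\<^bsub>V\<^esub>w\<in>{w. p w \<noteq> \<zero>\<^bsub>K\<^esub>}. p w \<odot>\<^bsub>V\<^esub> foldr (\<lambda>\<alpha>. lam V (\<one>\<^bsub>G\<^esub>, \<alpha>)) w v)"

definition halo_act ::
    "('k, 'm) ring_scheme \<Rightarrow> ('g, 'n) monoid_scheme \<Rightarrow> ('k, 'v, 'g \<times> 'e) rep
      \<Rightarrow> ('e list \<Rightarrow> 'k) set \<Rightarrow> 'v \<Rightarrow> 'v"
  where "halo_act K G V b v = the_elem ((\<lambda>p. free_act K G V p v) ` b)"


section \<open>\<open>Ext\<close> over the halo algebra\<close>

text \<open>The additive group of \<open>B\<^sub>E\<close>-linear maps. Maps are extensional, so that equality of
  functions is equality of maps.\<close>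

definition halo_hom ::
    "('k, 'm) ring_scheme \<Rightarrow> ('g, 'n) monoid_scheme \<Rightarrow> 'e set
      \<Rightarrow> ('k, 'v, 'g \<times> 'e) rep \<Rightarrow> ('k, 'w, 'g \<times> 'e) rep \<Rightarrow> ('v \<Rightarrow> 'w) monoid"
  where "halo_hom K G E Q W =
    \<lparr>carrier = {f \<in> carrier Q \<rightarrow>\<^sub>E carrier W.
       (\<forall>u\<in>carrier Q. \<forall>v\<in>carrier Q. f (u \<oplus>\<^bsub>Q\<^esub> v) = f u \<oplus>\<^bsub>W\<^esub> f v) \<and>
       (\<forall>b\<in>carrier (halo_algebra K E). \<forall>v\<in>carrier Q.
          f (halo_act K G Q b v) = halo_act K G W b (f v))},
     mult = (\<lambda>f g. \<lambda>v\<in>carrier Q. f v \<oplus>\<^bsub>W\<^esub> g v),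
     one = (\<lambda>v\<in>carrier Q. \<zero>\<^bsub>W\<^esub>)\<rparr>"

text \<open>\<open>\<rho>\<^sub>g\<close> is \<open>\<rho>\<^bsub>(g, \<alpha>)\<^esub>\<close> for any \<open>\<alpha>\<close> in \<open>E\<close>; the choice is immaterial.\<close>

definition rho_grp :: "'e set \<Rightarrow> ('k, 'v, 'g \<times> 'e) rep \<Rightarrow> 'g \<Rightarrow> 'v \<Rightarrow> 'v"
  where "rho_grp E V g = rho V (g, SOME \<alpha>. \<alpha> \<in> E)"

definition hom_act ::
    "'e set \<Rightarrow> ('k, 'v, 'g \<times> 'e) rep \<Rightarrow> ('k, 'w, 'g \<times> 'e) rep \<Rightarrow> 'g \<Rightarrow> ('v \<Rightarrow> 'w) \<Rightarrow> 'v \<Rightarrow> 'w"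
  where "hom_act E Q W g f =
    (\<lambda>q\<in>carrier Q. rho_grp E W g (f (inv_into (carrier Q) (rho_grp E Q g) q)))"

definition Ext1_cocycles ::
    "('k, 'm) ring_scheme \<Rightarrow> ('g, 'n) monoid_scheme \<Rightarrow> 'e set \<Rightarrow> ('k, 'v, 'g \<times> 'e) rep
      \<Rightarrow> (nat \<Rightarrow> ('k, 'v, 'g \<times> 'e) rep) \<Rightarrow> (nat \<Rightarrow> 'v \<Rightarrow> 'v) \<Rightarrow> ('v \<Rightarrow> 'v) set"
  where "Ext1_cocycles K G E Q I d =
    {f \<in> carrier (halo_hom K G E Q (I 1)). \<forall>q\<in>carrier Q. d 1 (f q) = \<zero>\<^bsub>I 2\<^esub>}"

definition Ext1_coboundaries ::
    "('k, 'm) ring_scheme \<Rightarrow> ('g, 'n) monoid_scheme \<Rightarrow> 'e set \<Rightarrow> ('k, 'v, 'g \<times> 'e) rep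
      \<Rightarrow> (nat \<Rightarrow> ('k, 'v, 'g \<times> 'e) rep) \<Rightarrow> (nat \<Rightarrow> 'v \<Rightarrow> 'v) \<Rightarrow> ('v \<Rightarrow> 'v) set"
  where "Ext1_coboundaries K G E Q I d =
    (\<lambda>h. \<lambda>q\<in>carrier Q. d 0 (h q)) ` carrier (halo_hom K G E Q (I 0))"

text \<open>The additive group \<open>Ext\<^sup>1(Q, W)\<close> over the halo algebra, computed as the first cohomology
  of \<open>Hom(Q, I)\<close> for an injective resolution \<open>(I, d)\<close> of \<open>W\<close> in \<open>Rep(D)\<close>.\<close>

definition Ext1 ::
    "('k, 'm) ring_scheme \<Rightarrow> ('g, 'n) monoid_scheme \<Rightarrow> 'e set \<Rightarrow> ('k, 'v, 'g \<times> 'e) rep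
      \<Rightarrow> (nat \<Rightarrow> ('k, 'v, 'g \<times> 'e) rep) \<Rightarrow> (nat \<Rightarrow> 'v \<Rightarrow> 'v) \<Rightarrow> ('v \<Rightarrow> 'v) set monoid"
  where "Ext1 K G E Q I d =
    (halo_hom K G E Q (I 1))\<lparr>carrier := Ext1_cocycles K G E Q I d\<rparr>
      Mod Ext1_coboundaries K G E Q I d"

text \<open>The coboundaries are stable under \<open>G\<close>, so \<open>g\<close> sends the class of \<open>f\<close> to its image under
  \<open>hom_act g\<close>, the class of \<open>g \<cdot> f\<close>.\<close>

definition Ext1_invariants ::
    "('k, 'm) ring_scheme \<Rightarrow> ('g, 'n) monoid_scheme \<Rightarrow> 'e set \<Rightarrow> ('k, 'v, 'g \<times> 'e) rep
      \<Rightarrow> (nat \<Rightarrow> ('k, 'v, 'g \<times> 'e) rep) \<Rightarrow> (nat \<Rightarrow> 'v \<Rightarrow> 'v) \<Rightarrow> ('v \<Rightarrow> 'v) set set"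
  where "Ext1_invariants K G E Q I d =
    {X \<in> carrier (Ext1 K G E Q I d). \<forall>g\<in>carrier G. hom_act E Q (I 1) g ` X = X}"

end

theory Submission
  imports Defs
begin

text \<open>If all short exact sequences of representations split, then every first extension group over the halo
  algebra vanishes, and with it its invariants; the theorem is the contrapositive.

  Let \<open>0 \<rightarrow> W \<rightarrow> I\<^sup>0 \<rightarrow> I\<^sup>1 \<rightarrow> I\<^sup>2\<close> be the start of an injective resolution and let
  \<open>Z \<subseteq> I\<^sup>1\<close> be the kernel of \<open>d\<^sup>1\<close>. It is a subrepresentation (\<open>kernel_rep\<close>) and, by
  exactness, the image of \<open>d\<^sup>0\<close>, so \<open>0 \<rightarrow> W \<rightarrow> I\<^sup>0 \<rightarrow> Z \<rightarrow> 0\<close> is a short exact sequence of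
  representations. If it splits by a section \<open>s\<close>, then a cocycle \<open>f : Q \<rightarrow> I\<^sup>1\<close>, which has values
  in \<open>Z\<close>, is \<open>d\<^sup>0 \<circ> (s \<circ> f)\<close>. Since \<open>s\<close> is a morphism of representations, it is linear over the
  halo algebra, so \<open>f\<close> is a coboundary (\<open>cocycle_is_coboundary\<close>). Thus the extension group has a
  single element. That element is fixed by the group since conjugation by \<open>\<rho>\<^sub>g\<close> permutes the
  cocycles (\<open>hom_act_cocycles\<close>).

  Most of the work lies in passing between maps that are linear over the halo algebra, an algebra given
  by generators and relations, and linear maps commuting with the operators of its generators
  (\<open>halo_hom_iff\<close>). This rests on the free algebra being a ring (\<open>free_algebra_ring\<close>), acting
  multiplicatively (\<open>free_act_mult\<close>), with the relations acting as zero
  (\<open>halo_ideal_annihilates\<close>).\<close>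

section \<open>Finite sums\<close>

text \<open>The form of associativity for the convolution product on words: a word of length \<open>n\<close> cut at
  positions \<open>j \<le> i\<close> contributes \<open>F j (i - j)\<close>, and the two bracketings enumerate the cuts in
  different orders.\<close>

lemma (in abelian_monoid) finsum_triangle:
  assumes F: "\<And>i j. F i j \<in> carrier G"
  shows "(\<Oplus>i\<in>{..n}. \<Oplus>j\<in>{..i}. F j (i - j)) = (\<Oplus>j\<in>{..n::nat}. \<Oplus>i\<in>{..n - j}. F j i)"
proof (induction n)
  case 0
  then show ?case by (simp add: F)
next
  case (Suc n)
  have "(\<Oplus>j\<in>{..n}. \<Oplus>i\<in>{..Suc n - j}. F j i)
      = (\<Oplus>j\<in>{..n}. F j (Suc n - j) \<oplus> (\<Oplus>i\<in>{..n - j}. F j i))"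
    by (rule finsum_cong') (auto simp: F Suc_diff_le)
  also have "\<dots> = (\<Oplus>j\<in>{..n}. F j (Suc n - j)) \<oplus> (\<Oplus>j\<in>{..n}. \<Oplus>i\<in>{..n - j}. F j i)"
    by (rule finsum_addf) (auto simp: F)
  finally show ?case
    using Suc.IH by (simp add: F a_ac)
qed

lemma (in abelian_monoid) finsum_fibres:
  assumes "finite S" "finite T" "f ` S \<subseteq> T" "g \<in> S \<rightarrow> carrier G"
  shows "(\<Oplus>t\<in>T. \<Oplus>s\<in>{s \<in> S. f s = t}. g s) = (\<Oplus>s\<in>S. g s)"
proof -
  have "(\<Oplus>s\<in>(\<Union>t\<in>T. {s \<in> S. f s = t}). g s) = (\<Oplus>t\<in>T. \<Oplus>s\<in>{s \<in> S. f s = t}. g s)"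
    by (rule add.finprod_UN_disjoint) (use assms in \<open>auto simp: pairwise_def disjnt_def\<close>)
  moreover have "(\<Union>t\<in>T. {s \<in> S. f s = t}) = S"
    using assms by auto
  ultimately show ?thesis by simp
qed

lemma (in abelian_monoid) finsum_Times:
  assumes "finite A" "finite B" "\<And>a b. a \<in> A \<Longrightarrow> b \<in> B \<Longrightarrow> g (a, b) \<in> carrier G"
  shows "(\<Oplus>a\<in>A. \<Oplus>b\<in>B. g (a, b)) = (\<Oplus>z\<in>A \<times> B. g z)"
proof -
  have "(\<Oplus>z\<in>A \<times> B. g z) = (\<Oplus>a\<in>A. \<Oplus>z\<in>{z \<in> A \<times> B. fst z = a}. g z)"
    by (rule finsum_fibres[symmetric]) (use assms in auto)
  also have "\<dots> = (\<Oplus>a\<in>A. \<Oplus>b\<in>B. g (a, b))"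
  proof (rule finsum_cong')
    fix a assume a: "a \<in> A"
    have "{z \<in> A \<times> B. fst z = a} = Pair a ` B"
      using a by auto
    then show "(\<Oplus>z\<in>{z \<in> A \<times> B. fst z = a}. g z) = (\<Oplus>b\<in>B. g (a, b))"
      using a assms(3) by (simp only: , subst finsum_reindex) (auto simp: inj_on_def)
  qed (use assms in auto)
  finally show ?thesis ..
qed

lemma (in module) finsum_smult_rdistr:
  assumes "finite A" "f \<in> A \<rightarrow> carrier R" "x \<in> carrier M"
  shows "(\<Oplus>\<^bsub>R\<^esub>i\<in>A. f i) \<odot>\<^bsub>M\<^esub> x = (\<Oplus>\<^bsub>M\<^esub>i\<in>A. f i \<odot>\<^bsub>M\<^esub> x)"
  using assms by (induction A rule: finite_induct) (auto simp: smult_l_distr Pi_def)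

section \<open>The free algebra is a ring\<close>

context cring
begin

lemma free_algebra_simps:
  "p \<in> carrier (free_algebra R E) \<longleftrightarrow>
     (\<forall>w. p w \<in> carrier R) \<and> finite {w. p w \<noteq> \<zero>} \<and> {w. p w \<noteq> \<zero>} \<subseteq> lists E"
  "p \<otimes>\<^bsub>free_algebra R E\<^esub> q = (\<lambda>w. \<Oplus>i\<in>{..length w}. p (take i w) \<otimes> q (drop i w))"
  "\<one>\<^bsub>free_algebra R E\<^esub> = word R []"
  "\<zero>\<^bsub>free_algebra R E\<^esub> = (\<lambda>w. \<zero>)"
  "p \<oplus>\<^bsub>free_algebra R E\<^esub> q = (\<lambda>w. p w \<oplus> q w)"
  by (simp_all add: free_algebra_def)

lemma free_algebra_coeff: "p \<in> carrier (free_algebra R E) \<Longrightarrow> p w \<in> carrier R"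
  unfolding free_algebra_simps by blast

lemma free_algebra_support: "p \<in> carrier (free_algebra R E) \<Longrightarrow> p w \<noteq> \<zero> \<Longrightarrow> w \<in> lists E"
  unfolding free_algebra_simps by blast

lemma free_algebraI:
  assumes "\<And>w. p w \<in> carrier R" "finite A" "A \<subseteq> lists E" "\<And>w. w \<notin> A \<Longrightarrow> p w = \<zero>"
  shows "p \<in> carrier (free_algebra R E)"
proof -
  have "{w. p w \<noteq> \<zero>} \<subseteq> A"
    using assms(4) by blast
  with assms(1-3) show ?thesis
    unfolding free_algebra_simps using finite_subset by blast
qed

lemma monomial_closed:
  assumes "c \<in> carrier R" "u \<in> lists E"
  shows "(\<lambda>w. if w = u then c else \<zero>) \<in> carrier (free_algebra R E)"
  by (rule free_algebraI[of _ "{u}"]) (use assms in auto)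

lemma free_algebra_mult_nonzero:
  assumes p: "\<And>w. p w \<in> carrier R" and q: "\<And>w. q w \<in> carrier R"
    and "(p \<otimes>\<^bsub>free_algebra R E\<^esub> q) w \<noteq> \<zero>"
  shows "\<exists>u v. w = u @ v \<and> p u \<noteq> \<zero> \<and> q v \<noteq> \<zero>"
proof (rule ccontr)
  assume contra: "\<not> ?thesis"
  have "p (take i w) \<otimes> q (drop i w) = \<zero>" for i
  proof -
    have "p (take i w) = \<zero> \<or> q (drop i w) = \<zero>"
      using contra append_take_drop_id[of i w] by metis
    then show ?thesis using p q by auto
  qed
  then show False using assms(3) by (simp add: free_algebra_simps)
qed

lemma free_algebra_abelian_group: "abelian_group (free_algebra R E)"
proof (rule abelian_groupI)
  show "x \<oplus>\<^bsub>free_algebra R E\<^esub> y \<in> carrier (free_algebra R E)"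
    if "x \<in> carrier (free_algebra R E)" "y \<in> carrier (free_algebra R E)" for x y
    by (rule free_algebraI[of _ "{w. x w \<noteq> \<zero>} \<union> {w. y w \<noteq> \<zero>}"])
      (use that in \<open>auto simp: free_algebra_simps\<close>)
  show "\<exists>y\<in>carrier (free_algebra R E). y \<oplus>\<^bsub>free_algebra R E\<^esub> x = \<zero>\<^bsub>free_algebra R E\<^esub>"
    if "x \<in> carrier (free_algebra R E)" for x
    by (rule bexI[of _ "\<lambda>w. \<ominus> x w"], simp add: free_algebra_simps l_neg that[unfolded free_algebra_simps],
        rule free_algebraI[of _ "{w. x w \<noteq> \<zero>}"])
      (use that in \<open>auto simp: free_algebra_simps\<close>)
qed (auto simp: free_algebra_simps a_ac)

text \<open>The ring laws matter here beyond the free algebra itself: \<open>Idl\<close> is an intersection of ideals, and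
  being an ideal presupposes a ring, so \<open>halo_ideal\<close> can only be bounded from above once they are
  known.\<close>

lemma free_algebra_ring: "ring (free_algebra R E)"
proof (rule ringI[OF free_algebra_abelian_group monoidI])
  let ?F = "free_algebra R E"
  show "p \<otimes>\<^bsub>?F\<^esub> q \<in> carrier ?F" if p: "p \<in> carrier ?F" and q: "q \<in> carrier ?F" for p q
  proof (rule free_algebraI)
    let ?A = "(\<lambda>(u, v). u @ v) ` ({u. p u \<noteq> \<zero>} \<times> {v. q v \<noteq> \<zero>})"
    show "finite ?A"
      using p q by (auto simp: free_algebra_simps)
    show "?A \<subseteq> lists E"
      using p q unfolding free_algebra_simps by (fastforce simp: subset_iff)
    show "(p \<otimes>\<^bsub>?F\<^esub> q) w = \<zero>" if "w \<notin> ?A" for w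
      using free_algebra_mult_nonzero[of p q E w] p q that by (force simp: free_algebra_simps(1))
    show "(p \<otimes>\<^bsub>?F\<^esub> q) w \<in> carrier R" for w
      using p q by (auto simp: free_algebra_simps)
  qed
  show "\<one>\<^bsub>?F\<^esub> \<in> carrier ?F"
    using monomial_closed[of \<one> "[]" E] by (simp add: free_algebra_simps(3) word_def)
  show "p \<otimes>\<^bsub>?F\<^esub> q \<otimes>\<^bsub>?F\<^esub> r = p \<otimes>\<^bsub>?F\<^esub> (q \<otimes>\<^bsub>?F\<^esub> r)"
    if "p \<in> carrier ?F" "q \<in> carrier ?F" "r \<in> carrier ?F" for p q r
  proof
    fix w :: "'c list"
    note c = that[unfolded free_algebra_simps(1)]
    define F where "F i j = p (take i w) \<otimes> (q (take j (drop i w)) \<otimes> r (drop (i + j) w))" for i j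
    have F: "F i j \<in> carrier R" for i j
      using c by (simp add: F_def)
    have "(p \<otimes>\<^bsub>?F\<^esub> q \<otimes>\<^bsub>?F\<^esub> r) w = (\<Oplus>i\<in>{..length w}. \<Oplus>j\<in>{..i}. F j (i - j))"
      unfolding free_algebra_simps
      by (rule finsum_cong')
        (use c F in \<open>auto simp: finsum_ldistr F_def m_assoc min_def drop_take take_take intro!: finsum_cong'\<close>)
    also have "\<dots> = (\<Oplus>j\<in>{..length w}. \<Oplus>i\<in>{..length w - j}. F j i)"
      by (rule finsum_triangle[OF F])
    also have "\<dots> = (p \<otimes>\<^bsub>?F\<^esub> (q \<otimes>\<^bsub>?F\<^esub> r)) w"
      unfolding free_algebra_simps
      by (rule finsum_cong')
        (use c F in \<open>auto simp: finsum_rdistr F_def add.commute intro!: finsum_cong'\<close>)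
    finally show "(p \<otimes>\<^bsub>?F\<^esub> q \<otimes>\<^bsub>?F\<^esub> r) w = (p \<otimes>\<^bsub>?F\<^esub> (q \<otimes>\<^bsub>?F\<^esub> r)) w" .
  qed
  show "\<one>\<^bsub>?F\<^esub> \<otimes>\<^bsub>?F\<^esub> p = p" if "p \<in> carrier ?F" for p
  proof
    fix w :: "'c list"
    note c = that[unfolded free_algebra_simps(1)]
    have "(\<one>\<^bsub>?F\<^esub> \<otimes>\<^bsub>?F\<^esub> p) w = (\<Oplus>i\<in>{..length w}. if 0 = i then p (drop i w) else \<zero>)"
      unfolding free_algebra_simps by (rule finsum_cong') (use c in \<open>auto simp: word_def\<close>)
    also have "\<dots> = p (drop (0) w)"
      by (rule finsum_singleton) (use c in auto)
    finally show "(\<one>\<^bsub>?F\<^esub> \<otimes>\<^bsub>?F\<^esub> p) w = p w"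
      by simp
  qed
  show "p \<otimes>\<^bsub>?F\<^esub> \<one>\<^bsub>?F\<^esub> = p" if "p \<in> carrier ?F" for p
  proof
    fix w :: "'c list"
    note c = that[unfolded free_algebra_simps(1)]
    have "(p \<otimes>\<^bsub>?F\<^esub> \<one>\<^bsub>?F\<^esub>) w = (\<Oplus>i\<in>{..length w}. if length w = i then p (take i w) else \<zero>)"
      unfolding free_algebra_simps by (rule finsum_cong') (use c in \<open>auto simp: word_def\<close>)
    also have "\<dots> = p (take (length w) w)"
      by (rule finsum_singleton) (use c in auto)
    finally show "(p \<otimes>\<^bsub>?F\<^esub> \<one>\<^bsub>?F\<^esub>) w = p w"
      by simp
  qed
  show "(p \<oplus>\<^bsub>?F\<^esub> q) \<otimes>\<^bsub>?F\<^esub> r = p \<otimes>\<^bsub>?F\<^esub> r \<oplus>\<^bsub>?F\<^esub> q \<otimes>\<^bsub>?F\<^esub> r"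
    if "p \<in> carrier ?F" "q \<in> carrier ?F" "r \<in> carrier ?F" for p q r
    using that[unfolded free_algebra_simps(1)] by (auto simp: free_algebra_simps l_distr finsum_addf)
  show "r \<otimes>\<^bsub>?F\<^esub> (p \<oplus>\<^bsub>?F\<^esub> q) = r \<otimes>\<^bsub>?F\<^esub> p \<oplus>\<^bsub>?F\<^esub> r \<otimes>\<^bsub>?F\<^esub> q"
    if "p \<in> carrier ?F" "q \<in> carrier ?F" "r \<in> carrier ?F" for p q r
    using that[unfolded free_algebra_simps(1)] by (auto simp: free_algebra_simps r_distr finsum_addf)
qed

end

section \<open>Linear maps\<close>

lemma linear_mapsD:
  assumes "f \<in> linear_maps K V W"
  shows "v \<in> carrier V \<Longrightarrow> f v \<in> carrier W"
    and "u \<in> carrier V \<Longrightarrow> v \<in> carrier V \<Longrightarrow> f (u \<oplus>\<^bsub>V\<^esub> v) = f u \<oplus>\<^bsub>W\<^esub> f v"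
    and "c \<in> carrier K \<Longrightarrow> v \<in> carrier V \<Longrightarrow> f (c \<odot>\<^bsub>V\<^esub> v) = c \<odot>\<^bsub>W\<^esub> f v"
  using assms by (auto simp: linear_maps_def)

lemma linear_maps_comp:
  assumes "f \<in> linear_maps K U V" "g \<in> linear_maps K V W"
  shows "(\<lambda>v. g (f v)) \<in> linear_maps K U W"
  using assms by (auto simp: linear_maps_def Pi_iff)

lemma linear_map_zero:
  assumes "module K V" "module K W" "f \<in> linear_maps K V W"
  shows "f \<zero>\<^bsub>V\<^esub> = \<zero>\<^bsub>W\<^esub>"
proof -
  interpret V: module K V by fact
  interpret W: module K W by fact
  have "f (\<zero>\<^bsub>K\<^esub> \<odot>\<^bsub>V\<^esub> \<zero>\<^bsub>V\<^esub>) = \<zero>\<^bsub>K\<^esub> \<odot>\<^bsub>W\<^esub> f \<zero>\<^bsub>V\<^esub>"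
    using assms(3) by (intro linear_mapsD(3)) auto
  then show ?thesis
    using linear_mapsD(1)[OF assms(3)] by simp
qed

lemma linear_map_finsum:
  assumes "module K V" "module K W" "f \<in> linear_maps K V W"
    and "finite A" "g \<in> A \<rightarrow> carrier V"
  shows "f (\<Oplus>\<^bsub>V\<^esub>i\<in>A. g i) = (\<Oplus>\<^bsub>W\<^esub>i\<in>A. f (g i))"
proof -
  interpret V: module K V by fact
  interpret W: module K W by fact
  from assms(4,5) show ?thesis
    by (induction A rule: finite_induct)
      (auto simp: Pi_def linear_map_zero[OF assms(1-3)] linear_mapsD[OF assms(3)])
qed

section \<open>The action of the halo algebra\<close>

text \<open>The part of a representation that the halo algebra sees. Isolating it keeps the group, and the
  operators at elements outside the halo, out of the algebra.\<close>

locale halo_module = module K V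
  for K :: "('k, 'm) ring_scheme" (structure)
    and V :: "('k, 'v, 'g \<times> 'e) rep" (structure) +
  fixes G :: "('g, 'n) monoid_scheme" and E :: "'e set"
  assumes lam_linear: "\<alpha> \<in> E \<Longrightarrow> lam V (\<one>\<^bsub>G\<^esub>, \<alpha>) \<in> linear_maps K V V"
    and lam_lam: "\<alpha> \<in> E \<Longrightarrow> \<beta> \<in> E \<Longrightarrow> v \<in> carrier V \<Longrightarrow>
      lam V (\<one>\<^bsub>G\<^esub>, \<alpha>) (lam V (\<one>\<^bsub>G\<^esub>, \<beta>) v) = lam V (\<one>\<^bsub>G\<^esub>, \<alpha>) v"
begin

abbreviation word_act :: "'e list \<Rightarrow> 'v \<Rightarrow> 'v"
  where "word_act w v \<equiv> foldr (\<lambda>\<alpha>. lam V (\<one>\<^bsub>G\<^esub>, \<alpha>)) w v"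

lemma word_act_linear: "w \<in> lists E \<Longrightarrow> word_act w \<in> linear_maps K V V"
proof (induction w)
  case Nil
  then show ?case by (simp add: linear_maps_def)
next
  case (Cons \<alpha> w)
  then show ?case
    using linear_maps_comp[of "word_act w" K V V "lam V (\<one>\<^bsub>G\<^esub>, \<alpha>)" V] lam_linear
    by (simp add: comp_def)
qed

lemma word_act_closed: "w \<in> lists E \<Longrightarrow> v \<in> carrier V \<Longrightarrow> word_act w v \<in> carrier V"
  by (rule linear_mapsD(1)[OF word_act_linear])

text \<open>The support of a sum or a product in the free algebra can be smaller than expected because of
  cancellation. Summing over any finite set of words containing the support avoids the case
  distinctions.\<close>

lemma free_act_superset:
  assumes p: "p \<in> carrier (free_algebra K E)" and v: "v \<in> carrier V"
    and A: "finite A" "A \<subseteq> lists E" "\<And>w. w \<notin> A \<Longrightarrow> p w = \<zero>\<^bsub>K\<^esub>"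
  shows "free_act K G V p v = (\<Oplus>\<^bsub>V\<^esub>w\<in>A. p w \<odot>\<^bsub>V\<^esub> word_act w v)"
  unfolding free_act_def
  by (rule M.add.finprod_mono_neutral_cong_left)
    (use assms word_act_closed in \<open>auto simp: R.free_algebra_simps(1) subset_iff Pi_def\<close>)

lemma free_act_term_closed:
  assumes "p \<in> carrier (free_algebra K E)" "v \<in> carrier V" "w \<in> lists E"
  shows "p w \<odot>\<^bsub>V\<^esub> word_act w v \<in> carrier V"
  using assms word_act_closed by (auto simp: R.free_algebra_simps(1))

lemma free_act_closed:
  assumes "p \<in> carrier (free_algebra K E)" "v \<in> carrier V"
  shows "free_act K G V p v \<in> carrier V"
  unfolding free_act_def
  by (rule M.finsum_closed)
    (use assms free_act_term_closed[OF assms] in \<open>auto simp: R.free_algebra_simps(1)\<close>)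

lemma free_act_add:
  assumes p: "p \<in> carrier (free_algebra K E)" and q: "q \<in> carrier (free_algebra K E)"
    and v: "v \<in> carrier V"
  shows "free_act K G V (p \<oplus>\<^bsub>free_algebra K E\<^esub> q) v = free_act K G V p v \<oplus>\<^bsub>V\<^esub> free_act K G V q v"
proof -
  interpret F: ring "free_algebra K E" by (rule R.free_algebra_ring)
  define A where "A = {w. p w \<noteq> \<zero>\<^bsub>K\<^esub>} \<union> {w. q w \<noteq> \<zero>\<^bsub>K\<^esub>}"
  have c: "p w \<in> carrier K" "q w \<in> carrier K" for w
    using p q by (auto simp: R.free_algebra_simps(1))
  have A: "finite A" "A \<subseteq> lists E"
    using p q by (auto simp: R.free_algebra_simps(1) A_def)
  have W: "word_act w v \<in> carrier V" if "w \<in> A" for w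
    using that A(2) v by (intro word_act_closed) auto
  have eq: "free_act K G V r v = (\<Oplus>\<^bsub>V\<^esub>w\<in>A. r w \<odot>\<^bsub>V\<^esub> word_act w v)"
    if "r \<in> carrier (free_algebra K E)" "\<And>w. w \<notin> A \<Longrightarrow> r w = \<zero>\<^bsub>K\<^esub>" for r
    using that v A by (intro free_act_superset)
  have "free_act K G V (p \<oplus>\<^bsub>free_algebra K E\<^esub> q) v
      = (\<Oplus>\<^bsub>V\<^esub>w\<in>A. (p \<oplus>\<^bsub>free_algebra K E\<^esub> q) w \<odot>\<^bsub>V\<^esub> word_act w v)"
    by (rule eq[OF F.a_closed[OF p q]]) (auto simp: R.free_algebra_simps(5) A_def)
  also have "\<dots> = (\<Oplus>\<^bsub>V\<^esub>w\<in>A. p w \<odot>\<^bsub>V\<^esub> word_act w v \<oplus>\<^bsub>V\<^esub> q w \<odot>\<^bsub>V\<^esub> word_act w v)"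
    by (rule M.finsum_cong')
      (use A c v W in \<open>auto simp: R.free_algebra_simps(5) smult_l_distr\<close>)
  also have "\<dots> = (\<Oplus>\<^bsub>V\<^esub>w\<in>A. p w \<odot>\<^bsub>V\<^esub> word_act w v) \<oplus>\<^bsub>V\<^esub> (\<Oplus>\<^bsub>V\<^esub>w\<in>A. q w \<odot>\<^bsub>V\<^esub> word_act w v)"
    by (rule M.finsum_addf) (use A c v W in auto)
  also have "(\<Oplus>\<^bsub>V\<^esub>w\<in>A. p w \<odot>\<^bsub>V\<^esub> word_act w v) = free_act K G V p v"
    by (rule eq[symmetric]) (use p in \<open>auto simp: A_def\<close>)
  also have "(\<Oplus>\<^bsub>V\<^esub>w\<in>A. q w \<odot>\<^bsub>V\<^esub> word_act w v) = free_act K G V q v"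
    by (rule eq[symmetric]) (use q in \<open>auto simp: A_def\<close>)
  finally show ?thesis .
qed

lemma free_act_monomial:
  assumes "c \<in> carrier K" "u \<in> lists E" "v \<in> carrier V"
  shows "free_act K G V (\<lambda>w. if w = u then c else \<zero>\<^bsub>K\<^esub>) v = c \<odot>\<^bsub>V\<^esub> word_act u v"
proof -
  have "free_act K G V (\<lambda>w. if w = u then c else \<zero>\<^bsub>K\<^esub>) v
      = (\<Oplus>\<^bsub>V\<^esub>w\<in>{u}. (if w = u then c else \<zero>\<^bsub>K\<^esub>) \<odot>\<^bsub>V\<^esub> word_act w v)"
    by (rule free_act_superset[OF R.monomial_closed[OF assms(1,2)]]) (use assms in auto)
  then show ?thesis
    using assms word_act_closed by simp
qed

text \<open>Both sides are the sum of \<open>(p u \<otimes> q u') \<odot> (u u' \<cdot> v)\<close> over pairs of words from the two supports.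
  On the left the pairs arrive grouped by the concatenation \<open>w = u u'\<close>: the cuts of \<open>w\<close> contributing
  to the convolution are exactly the pairs in the fibre over \<open>w\<close>.\<close>

lemma free_act_mult:
  assumes p: "p \<in> carrier (free_algebra K E)" and q: "q \<in> carrier (free_algebra K E)"
    and v: "v \<in> carrier V"
  shows "free_act K G V (p \<otimes>\<^bsub>free_algebra K E\<^esub> q) v = free_act K G V p (free_act K G V q v)"
proof -
  interpret F: ring "free_algebra K E" by (rule R.free_algebra_ring)
  define P where "P = {w. p w \<noteq> \<zero>\<^bsub>K\<^esub>}"
  define Q where "Q = {w. q w \<noteq> \<zero>\<^bsub>K\<^esub>}"
  define g where "g = (\<lambda>(u, u'). (p u \<otimes>\<^bsub>K\<^esub> q u') \<odot>\<^bsub>V\<^esub> word_act (u @ u') v)"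
  define A where "A = (\<lambda>(u, u'). u @ u') ` (P \<times> Q)"
  have c: "p w \<in> carrier K" "q w \<in> carrier K" for w
    using p q by (auto simp: R.free_algebra_simps(1))
  have PQ: "finite P" "finite Q" "P \<subseteq> lists E" "Q \<subseteq> lists E"
    using p q by (auto simp: R.free_algebra_simps(1) P_def Q_def)
  have A: "finite A" "A \<subseteq> lists E"
    using PQ unfolding A_def by (fastforce simp: subset_iff)+
  have g_closed: "g (u, u') \<in> carrier V" if "u \<in> lists E" "u' \<in> lists E" for u u'
    using word_act_closed[of "u @ u'" v] that v c by (simp add: g_def)
  have g_PQ: "g z \<in> carrier V" if "z \<in> P \<times> Q" for z
    using that PQ(3,4) g_closed by blast
  have term_Q: "q u' \<odot>\<^bsub>V\<^esub> word_act u' v \<in> carrier V" if "u' \<in> Q" for u'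
    using that PQ(4) free_act_term_closed[OF q v] by blast
  have pq0: "(p \<otimes>\<^bsub>free_algebra K E\<^esub> q) w = \<zero>\<^bsub>K\<^esub>" if "w \<notin> A" for w
    using R.free_algebra_mult_nonzero[of p q E w, OF c] that
    by (force simp: A_def P_def Q_def)
  have inner: "(p \<otimes>\<^bsub>free_algebra K E\<^esub> q) w \<odot>\<^bsub>V\<^esub> word_act w v
      = (\<Oplus>\<^bsub>V\<^esub>z\<in>{z \<in> P \<times> Q. (\<lambda>(u, u'). u @ u') z = w}. g z)" if w: "w \<in> lists E" for w
  proof -
    let ?cut = "\<lambda>i. (take i w, drop i w)"
    have td: "take i w \<in> lists E" "drop i w \<in> lists E" for i
      using w by (auto dest: in_set_takeD in_set_dropD)
    have inj: "inj_on ?cut {..length w}"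
      by (rule inj_onI) (metis atMost_iff length_take min.absorb2 prod.inject)
    have "(p \<otimes>\<^bsub>free_algebra K E\<^esub> q) w \<odot>\<^bsub>V\<^esub> word_act w v
        = (\<Oplus>\<^bsub>V\<^esub>i\<in>{..length w}. (p (take i w) \<otimes>\<^bsub>K\<^esub> q (drop i w)) \<odot>\<^bsub>V\<^esub> word_act w v)"
      unfolding R.free_algebra_simps(2)
      by (rule finsum_smult_rdistr) (use c w v word_act_closed in auto)
    also have "\<dots> = (\<Oplus>\<^bsub>V\<^esub>i\<in>{..length w}. g (?cut i))"
      by (simp add: g_def flip: foldr_append)
    also have "\<dots> = (\<Oplus>\<^bsub>V\<^esub>z\<in>?cut ` {..length w}. g z)"
      by (rule M.finsum_reindex[symmetric]) (use inj g_closed td in auto)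
    also have "\<dots> = (\<Oplus>\<^bsub>V\<^esub>z\<in>{z \<in> P \<times> Q. (\<lambda>(u, u'). u @ u') z = w}. g z)"
    proof (rule M.add.finprod_mono_neutral_cong_right)
      show "{z \<in> P \<times> Q. (\<lambda>(u, u'). u @ u') z = w} \<subseteq> ?cut ` {..length w}"
      proof
        fix z assume "z \<in> {z \<in> P \<times> Q. (\<lambda>(u, u'). u @ u') z = w}"
        then obtain u u' where "z = (u, u')" "u @ u' = w" by auto
        then show "z \<in> ?cut ` {..length w}"
          by (intro image_eqI[of _ _ "length u"]) auto
      qed
      show "g z = \<zero>\<^bsub>V\<^esub>"
        if z: "z \<in> ?cut ` {..length w} - {z \<in> P \<times> Q. (\<lambda>(u, u'). u @ u') z = w}" for z
      proof -
        obtain i where i: "z = ?cut i" using z by blast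
        then have "p (take i w) = \<zero>\<^bsub>K\<^esub> \<or> q (drop i w) = \<zero>\<^bsub>K\<^esub>"
          using z by (auto simp: P_def Q_def)
        then show ?thesis
          using c w v word_act_closed[of w v] by (auto simp: i g_def simp flip: foldr_append)
      qed
    qed (use g_closed td in auto)
    finally show ?thesis .
  qed
  have "free_act K G V (p \<otimes>\<^bsub>free_algebra K E\<^esub> q) v
      = (\<Oplus>\<^bsub>V\<^esub>w\<in>A. (p \<otimes>\<^bsub>free_algebra K E\<^esub> q) w \<odot>\<^bsub>V\<^esub> word_act w v)"
    using p q v A pq0 by (intro free_act_superset) auto
  also have "\<dots> = (\<Oplus>\<^bsub>V\<^esub>w\<in>A. \<Oplus>\<^bsub>V\<^esub>z\<in>{z \<in> P \<times> Q. (\<lambda>(u, u'). u @ u') z = w}. g z)"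
  proof (rule M.finsum_cong')
    show "(\<lambda>w. \<Oplus>\<^bsub>V\<^esub>z\<in>{z \<in> P \<times> Q. (\<lambda>(u, u'). u @ u') z = w}. g z) \<in> A \<rightarrow> carrier V"
      by (intro Pi_I M.finsum_closed) (use g_PQ in blast)
  qed (use A(2) inner in blast)+
  also have "\<dots> = (\<Oplus>\<^bsub>V\<^esub>z\<in>P \<times> Q. g z)"
    by (rule M.finsum_fibres) (use A(1) PQ(1,2) g_PQ in \<open>auto simp: A_def\<close>)
  also have "\<dots> = (\<Oplus>\<^bsub>V\<^esub>u\<in>P. \<Oplus>\<^bsub>V\<^esub>u'\<in>Q. g (u, u'))"
    by (rule M.finsum_Times[symmetric]) (use PQ(1,2) g_PQ in auto)
  also have "\<dots> = (\<Oplus>\<^bsub>V\<^esub>u\<in>P. p u \<odot>\<^bsub>V\<^esub> word_act u (free_act K G V q v))"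
  proof (rule M.finsum_cong')
    fix u assume "u \<in> P"
    then have u: "u \<in> lists E" using PQ(3) by blast
    have "word_act u (free_act K G V q v) = (\<Oplus>\<^bsub>V\<^esub>u'\<in>Q. word_act u (q u' \<odot>\<^bsub>V\<^esub> word_act u' v))"
      unfolding free_act_def Q_def[symmetric]
      by (rule linear_map_finsum[OF module_axioms module_axioms word_act_linear[OF u]])
        (use PQ(2) term_Q in auto)
    also have "p u \<odot>\<^bsub>V\<^esub> \<dots> = (\<Oplus>\<^bsub>V\<^esub>u'\<in>Q. p u \<odot>\<^bsub>V\<^esub> word_act u (q u' \<odot>\<^bsub>V\<^esub> word_act u' v))"
      by (rule finsum_smult_ldistr)
        (use PQ(2) c(1) word_act_closed[OF u] term_Q in auto)
    also have "\<dots> = (\<Oplus>\<^bsub>V\<^esub>u'\<in>Q. g (u, u'))"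
    proof (rule M.finsum_cong')
      fix u' assume "u' \<in> Q"
      then have "u' \<in> lists E" using PQ(4) by blast
      then show "p u \<odot>\<^bsub>V\<^esub> word_act u (q u' \<odot>\<^bsub>V\<^esub> word_act u' v) = g (u, u')"
        using c u v word_act_closed[of u' v] word_act_closed[of u "word_act u' v"]
        by (simp add: g_def linear_mapsD(3)[OF word_act_linear[OF u]] smult_assoc1)
    qed (use \<open>u \<in> P\<close> g_PQ in auto)
    finally show "(\<Oplus>\<^bsub>V\<^esub>u'\<in>Q. g (u, u')) = p u \<odot>\<^bsub>V\<^esub> word_act u (free_act K G V q v)" ..
  next
    show "(\<lambda>u. p u \<odot>\<^bsub>V\<^esub> word_act u (free_act K G V q v)) \<in> P \<rightarrow> carrier V"
      using PQ(3) free_act_term_closed[OF p free_act_closed[OF q v]] by blast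
  qed simp
  also have "\<dots> = free_act K G V p (free_act K G V q v)"
    by (simp add: free_act_def P_def)
  finally show ?thesis .
qed

lemma free_act_zero: "v \<in> carrier V \<Longrightarrow> free_act K G V \<zero>\<^bsub>free_algebra K E\<^esub> v = \<zero>\<^bsub>V\<^esub>"
  by (simp add: free_act_def R.free_algebra_simps(4))

lemma free_act_at_zero:
  assumes "p \<in> carrier (free_algebra K E)"
  shows "free_act K G V p \<zero>\<^bsub>V\<^esub> = \<zero>\<^bsub>V\<^esub>"
  unfolding free_act_def
proof (rule M.add.finprod_one_eqI[simplified])
  fix w assume "w \<in> {w. p w \<noteq> \<zero>\<^bsub>K\<^esub>}"
  then have "word_act w \<zero>\<^bsub>V\<^esub> = \<zero>\<^bsub>V\<^esub>"
    using R.free_algebra_support[OF assms]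
    by (intro linear_map_zero[OF module_axioms module_axioms word_act_linear]) blast
  then show "p w \<odot>\<^bsub>V\<^esub> word_act w \<zero>\<^bsub>V\<^esub> = \<zero>\<^bsub>V\<^esub>"
    using R.free_algebra_coeff[OF assms] by simp
qed

lemma free_act_uminus:
  assumes p: "p \<in> carrier (free_algebra K E)" and v: "v \<in> carrier V"
  shows "free_act K G V (\<ominus>\<^bsub>free_algebra K E\<^esub> p) v = \<ominus>\<^bsub>V\<^esub> free_act K G V p v"
proof -
  interpret F: ring "free_algebra K E" by (rule R.free_algebra_ring)
  have "free_act K G V (\<ominus>\<^bsub>free_algebra K E\<^esub> p) v \<oplus>\<^bsub>V\<^esub> free_act K G V p v = \<zero>\<^bsub>V\<^esub>"
    using p v by (simp add: F.l_neg free_act_zero flip: free_act_add)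
  then show ?thesis
    using p v free_act_closed by (simp add: M.minus_equality)
qed

definition annihilator :: "('e list \<Rightarrow> 'k) set"
  where "annihilator =
    {p \<in> carrier (free_algebra K E). \<forall>v\<in>carrier V. free_act K G V p v = \<zero>\<^bsub>V\<^esub>}"

text \<open>Closure under multiplication on both sides is where multiplicativity of the action enters.\<close>

lemma annihilator_ideal: "ideal annihilator (free_algebra K E)"
proof -
  interpret F: ring "free_algebra K E" by (rule R.free_algebra_ring)
  show ?thesis
  proof (rule idealI[OF F.ring_axioms F.add.subgroupI])
    show "annihilator \<noteq> {}"
      using free_act_zero by (auto simp: annihilator_def intro!: exI[of _ "\<zero>\<^bsub>free_algebra K E\<^esub>"])
  qed (auto simp: annihilator_def free_act_add free_act_mult free_act_closed free_act_at_zero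
       free_act_uminus simp flip: a_inv_def)
qed

lemma word_closed: "u \<in> lists E \<Longrightarrow> word K u \<in> carrier (free_algebra K E)"
  using R.monomial_closed[of "\<one>\<^bsub>K\<^esub>" u E] by (simp add: word_def)

lemma free_act_word:
  assumes "u \<in> lists E" "v \<in> carrier V"
  shows "free_act K G V (word K u) v = word_act u v"
  using free_act_monomial[of "\<one>\<^bsub>K\<^esub>" u v] assms word_act_closed by (simp add: word_def)

lemma halo_ideal_ideal: "ideal (halo_ideal K E) (free_algebra K E)"
proof -
  interpret F: ring "free_algebra K E" by (rule R.free_algebra_ring)
  show ?thesis
    unfolding halo_ideal_def by (rule F.genideal_ideal) (auto simp: word_closed)
qed

text \<open>The generators act as zero because \<open>\<epsilon>\<^sub>\<alpha> \<epsilon>\<^sub>\<beta> = \<epsilon>\<^sub>\<alpha>\<close> holds for the operators, and the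
  annihilator is an ideal.\<close>

lemma halo_ideal_annihilates: "halo_ideal K E \<subseteq> annihilator"
proof -
  interpret F: ring "free_algebra K E" by (rule R.free_algebra_ring)
  have "free_act K G V (word K [\<alpha>] \<otimes>\<^bsub>free_algebra K E\<^esub> word K [\<beta>] \<ominus>\<^bsub>free_algebra K E\<^esub> word K [\<alpha>]) v = \<zero>\<^bsub>V\<^esub>"
    if "\<alpha> \<in> E" "\<beta> \<in> E" "v \<in> carrier V" for \<alpha> \<beta> v
    using that lam_lam[of \<alpha> \<beta> v] word_act_closed[of "[\<alpha>]" v] word_act_closed[of "[\<beta>]" v]
    by (simp add: F.minus_eq free_act_add free_act_uminus free_act_mult free_act_word word_closed
        M.r_neg)
  then show ?thesis
    unfolding halo_ideal_def
    by (intro F.genideal_minimal annihilator_ideal) (auto simp: annihilator_def word_closed)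
qed

text \<open>All members of a coset act alike because the ideal acts as zero, so the set passed to \<open>the_elem\<close> in
  \<open>halo_act_def\<close> is a singleton.\<close>

lemma halo_act_coset:
  assumes p: "p \<in> carrier (free_algebra K E)" and v: "v \<in> carrier V"
  shows "halo_act K G V (halo_ideal K E +>\<^bsub>free_algebra K E\<^esub> p) v = free_act K G V p v"
proof -
  interpret F: ring "free_algebra K E" by (rule R.free_algebra_ring)
  interpret J: ideal "halo_ideal K E" "free_algebra K E" by (rule halo_ideal_ideal)
  have "free_act K G V x v = free_act K G V p v"
    if x: "x \<in> halo_ideal K E +>\<^bsub>free_algebra K E\<^esub> p" for x
  proof -
    obtain h where h: "h \<in> halo_ideal K E" "x = h \<oplus>\<^bsub>free_algebra K E\<^esub> p"
      using x by (auto simp: a_r_coset_def')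
    then have "free_act K G V h v = \<zero>\<^bsub>V\<^esub>"
      using halo_ideal_annihilates v by (auto simp: annihilator_def)
    then show ?thesis
      using h p v free_act_closed by (simp add: free_act_add)
  qed
  moreover have "p \<in> halo_ideal K E +>\<^bsub>free_algebra K E\<^esub> p"
    by (rule J.a_rcos_self[OF p])
  ultimately have "(\<lambda>x. free_act K G V x v) ` (halo_ideal K E +>\<^bsub>free_algebra K E\<^esub> p)
      = {free_act K G V p v}"
    by blast
  then show ?thesis by (simp add: halo_act_def)
qed

lemma halo_algebra_carrier:
  "carrier (halo_algebra K E) = (\<lambda>p. halo_ideal K E +>\<^bsub>free_algebra K E\<^esub> p) ` carrier (free_algebra K E)"
  by (auto simp: halo_algebra_def FactRing_def A_RCOSETS_def' a_r_coset_def')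

end

text \<open>Linearity over the halo algebra can be tested on the scalars and the generators. With this criterion
  cosets and words disappear from the rest of the argument. Compatibility with
  scalars is recovered from the multiples of the empty word.\<close>

lemma halo_hom_iff:
  fixes Q :: "('k, 'v, 'g \<times> 'e) rep" and W :: "('k, 'w, 'g \<times> 'e) rep"
  assumes "halo_module K Q G E" "halo_module K W G E"
  shows "f \<in> carrier (halo_hom K G E Q W) \<longleftrightarrow>
    f \<in> extensional (carrier Q) \<and> f \<in> linear_maps K Q W \<and>
    (\<forall>\<alpha>\<in>E. \<forall>v\<in>carrier Q. f (lam Q (\<one>\<^bsub>G\<^esub>, \<alpha>) v) = lam W (\<one>\<^bsub>G\<^esub>, \<alpha>) (f v))"
proof -
  interpret Q: halo_module K Q G E by fact
  interpret W: halo_module K W G E by fact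
  let ?act = "free_act K G"
  have "f \<in> carrier (halo_hom K G E Q W) \<longleftrightarrow>
      f \<in> extensional (carrier Q) \<and> f \<in> carrier Q \<rightarrow> carrier W \<and>
      (\<forall>u\<in>carrier Q. \<forall>v\<in>carrier Q. f (u \<oplus>\<^bsub>Q\<^esub> v) = f u \<oplus>\<^bsub>W\<^esub> f v) \<and>
      (\<forall>p\<in>carrier (free_algebra K E). \<forall>v\<in>carrier Q. f (?act Q p v) = ?act W p (f v))"
    (is "_ \<longleftrightarrow> ?R")
    by (auto simp: halo_hom_def Q.halo_algebra_carrier Q.halo_act_coset W.halo_act_coset
        PiE_def Pi_iff)
  also have "?R \<longleftrightarrow> f \<in> extensional (carrier Q) \<and> f \<in> linear_maps K Q W \<and>
    (\<forall>\<alpha>\<in>E. \<forall>v\<in>carrier Q. f (lam Q (\<one>\<^bsub>G\<^esub>, \<alpha>) v) = lam W (\<one>\<^bsub>G\<^esub>, \<alpha>) (f v))" (is "_ \<longleftrightarrow> ?S")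
  proof
    assume R: ?R
    have "f (c \<odot>\<^bsub>Q\<^esub> v) = c \<odot>\<^bsub>W\<^esub> f v" if "c \<in> carrier K" "v \<in> carrier Q" for c v
    proof -
      have "f v \<in> carrier W" using R that by auto
      moreover have "f (?act Q (\<lambda>w. if w = [] then c else \<zero>\<^bsub>K\<^esub>) v)
          = ?act W (\<lambda>w. if w = [] then c else \<zero>\<^bsub>K\<^esub>) (f v)"
        using R that Q.R.monomial_closed[of c "[]" E] by blast
      ultimately show ?thesis
        using that Q.free_act_monomial[of c "[]" v] W.free_act_monomial[of c "[]" "f v"] by simp
    qed
    moreover have "f (lam Q (\<one>\<^bsub>G\<^esub>, \<alpha>) v) = lam W (\<one>\<^bsub>G\<^esub>, \<alpha>) (f v)"
      if "\<alpha> \<in> E" "v \<in> carrier Q" for \<alpha> v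
    proof -
      have "f v \<in> carrier W" using R that by auto
      moreover have "f (?act Q (word K [\<alpha>]) v) = ?act W (word K [\<alpha>]) (f v)"
        using R that Q.word_closed[of "[\<alpha>]"] by simp
      ultimately show ?thesis
        using that Q.free_act_word[of "[\<alpha>]" v] W.free_act_word[of "[\<alpha>]" "f v"] by simp
    qed
    ultimately show ?S using R by (auto simp: linear_maps_def)
  next
    assume S: ?S
    then have lin: "f \<in> linear_maps K Q W" by blast
    have words: "f (Q.word_act w v) = W.word_act w (f v)" if "w \<in> lists E" "v \<in> carrier Q" for w v
      using that S Q.word_act_closed by (induction w) auto
    have "f (?act Q p v) = ?act W p (f v)"
      if p: "p \<in> carrier (free_algebra K E)" and v: "v \<in> carrier Q" for p v
    proof -
      have "f (?act Q p v) = (\<Oplus>\<^bsub>W\<^esub>w\<in>{w. p w \<noteq> \<zero>\<^bsub>K\<^esub>}. f (p w \<odot>\<^bsub>Q\<^esub> Q.word_act w v))"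
        unfolding free_act_def
        by (rule linear_map_finsum[OF Q.module_axioms W.module_axioms lin])
          (use p Q.free_act_term_closed[OF p v] in \<open>auto simp: Q.R.free_algebra_simps(1)\<close>)
      also have "\<dots> = ?act W p (f v)"
        unfolding free_act_def
      proof (rule W.M.finsum_cong')
        fix w assume "w \<in> {w. p w \<noteq> \<zero>\<^bsub>K\<^esub>}"
        then have "w \<in> lists E" "p w \<in> carrier K"
          using p by (auto simp: Q.R.free_algebra_simps(1))
        then show "f (p w \<odot>\<^bsub>Q\<^esub> Q.word_act w v) = p w \<odot>\<^bsub>W\<^esub> W.word_act w (f v)"
          using v Q.word_act_closed by (simp add: linear_mapsD(3)[OF lin] words)
      next
        show "(\<lambda>w. p w \<odot>\<^bsub>W\<^esub> W.word_act w (f v)) \<in> {w. p w \<noteq> \<zero>\<^bsub>K\<^esub>} \<rightarrow> carrier W"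
          by (rule Pi_I, rule W.free_act_term_closed[OF p linear_mapsD(1)[OF lin v]],
              rule Q.R.free_algebra_support[OF p]) simp
      qed simp
      finally show ?thesis .
    qed
    then show ?R using S by (auto simp: linear_maps_def)
  qed
  finally show ?thesis .
qed

lemma (in halo_module) halo_hom_group:
  assumes "halo_module K W G E"
  shows "group (halo_hom K G E V W)"
proof (rule groupI)
  interpret W: halo_module K W G E by fact
  let ?H = "halo_hom K G E V W"
  note iff = halo_hom_iff[OF halo_module_axioms assms]
  have mult: "f \<otimes>\<^bsub>?H\<^esub> g = (\<lambda>v\<in>carrier V. f v \<oplus>\<^bsub>W\<^esub> g v)" for f g
    by (simp add: halo_hom_def)
  have one: "\<one>\<^bsub>?H\<^esub> = (\<lambda>v\<in>carrier V. \<zero>\<^bsub>W\<^esub>)"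
    by (simp add: halo_hom_def)
  have closed: "f v \<in> carrier W" if "f \<in> carrier ?H" "v \<in> carrier V" for f v
    using that linear_mapsD(1)[of f K V W v] by (simp add: iff)
  have lamV: "lam V (\<one>\<^bsub>G\<^esub>, \<alpha>) v \<in> carrier V" if "\<alpha> \<in> E" "v \<in> carrier V" for \<alpha> v
    using linear_mapsD(1)[OF lam_linear] that by blast
  have lamW: "lam W (\<one>\<^bsub>G\<^esub>, \<alpha>) \<zero>\<^bsub>W\<^esub> = \<zero>\<^bsub>W\<^esub>" if "\<alpha> \<in> E" for \<alpha>
    using linear_map_zero[OF W.module_axioms W.module_axioms W.lam_linear] that by blast
  show "f \<otimes>\<^bsub>?H\<^esub> g \<in> carrier ?H" if "f \<in> carrier ?H" "g \<in> carrier ?H" for f g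
    using that closed[OF that(1)] closed[OF that(2)] unfolding iff mult
    by (auto simp: linear_maps_def W.M.a_ac W.smult_r_distr lamV linear_mapsD(2)[OF W.lam_linear])
  show "\<one>\<^bsub>?H\<^esub> \<in> carrier ?H"
    unfolding iff one by (auto simp: linear_maps_def lamV lamW)
  show "f \<otimes>\<^bsub>?H\<^esub> g \<otimes>\<^bsub>?H\<^esub> h = f \<otimes>\<^bsub>?H\<^esub> (g \<otimes>\<^bsub>?H\<^esub> h)"
    if "f \<in> carrier ?H" "g \<in> carrier ?H" "h \<in> carrier ?H" for f g h
    using that closed by (auto simp: mult W.M.a_assoc intro!: restrict_ext)
  show "\<one>\<^bsub>?H\<^esub> \<otimes>\<^bsub>?H\<^esub> f = f" if "f \<in> carrier ?H" for f
    by (rule extensionalityI[of _ "carrier V"])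
      (use that closed in \<open>auto simp: mult one iff\<close>)
  show "\<exists>g\<in>carrier ?H. g \<otimes>\<^bsub>?H\<^esub> f = \<one>\<^bsub>?H\<^esub>" if f: "f \<in> carrier ?H" for f
  proof (rule bexI)
    let ?g = "\<lambda>v\<in>carrier V. \<ominus>\<^bsub>W\<^esub> f v"
    show "?g \<otimes>\<^bsub>?H\<^esub> f = \<one>\<^bsub>?H\<^esub>"
      using closed[OF f] by (auto simp: mult one W.M.l_neg intro!: restrict_ext)
    have "\<ominus>\<^bsub>W\<^esub> lam W (\<one>\<^bsub>G\<^esub>, \<alpha>) w = lam W (\<one>\<^bsub>G\<^esub>, \<alpha>) (\<ominus>\<^bsub>W\<^esub> w)"
      if "\<alpha> \<in> E" "w \<in> carrier W" for \<alpha> w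
      using that linear_mapsD(1)[OF W.lam_linear]
      by (intro W.M.minus_equality) (simp_all add: lamW W.M.l_neg flip: linear_mapsD(2)[OF W.lam_linear])
    then show "?g \<in> carrier ?H"
      using f closed[OF f] unfolding iff
      by (auto simp: linear_maps_def W.M.minus_add W.M.a_ac W.smult_r_minus lamV)
  qed
qed

section \<open>Representations and the conjugation action of the group\<close>

locale digroup_action = cring K + act: group_action G E \<phi>
  for K :: "('k, 'm) ring_scheme" and G :: "('g, 'n) monoid_scheme"
    and E :: "'e set" and \<phi> :: "'g \<Rightarrow> 'e \<Rightarrow> 'e" +
  assumes nonempty: "E \<noteq> {}"
begin

abbreviation D :: "('g \<times> 'e) digroup"
  where "D \<equiv> action_digroup G E \<phi>"

sublocale G: group G
  using act.group_hom by (rule group_hom.axioms(1))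

lemma repD:
  assumes "is_rep K D V"
  shows "module K V"
    and "\<And>g \<alpha>. g \<in> carrier G \<Longrightarrow> \<alpha> \<in> E \<Longrightarrow> lam V (g, \<alpha>) \<in> linear_maps K V V"
    and "\<And>g \<alpha>. g \<in> carrier G \<Longrightarrow> \<alpha> \<in> E \<Longrightarrow> rho V (g, \<alpha>) \<in> linear_maps K V V"
    and "\<And>g \<alpha> h \<beta> v. g \<in> carrier G \<Longrightarrow> h \<in> carrier G \<Longrightarrow> \<alpha> \<in> E \<Longrightarrow> \<beta> \<in> E \<Longrightarrow> v \<in> carrier V \<Longrightarrow>
      lam V (g, \<alpha>) (lam V (h, \<beta>) v) = lam V (g \<otimes>\<^bsub>G\<^esub> h, \<alpha>) v"
    and "\<And>g \<alpha> h \<beta> v. g \<in> carrier G \<Longrightarrow> h \<in> carrier G \<Longrightarrow> \<alpha> \<in> E \<Longrightarrow> \<beta> \<in> E \<Longrightarrow> v \<in> carrier V \<Longrightarrow>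
      rho V (g, \<alpha>) (rho V (h, \<beta>) v) = rho V (g \<otimes>\<^bsub>G\<^esub> h, \<phi> g \<beta>) v"
    and "\<And>g \<alpha> h \<beta> v. g \<in> carrier G \<Longrightarrow> h \<in> carrier G \<Longrightarrow> \<alpha> \<in> E \<Longrightarrow> \<beta> \<in> E \<Longrightarrow> v \<in> carrier V \<Longrightarrow>
      rho V (g, \<alpha>) (lam V (h, \<beta>) v) = lam V (g \<otimes>\<^bsub>G\<^esub> h, \<phi> g \<beta>) v"
    and "\<And>g \<alpha> h \<beta> v. g \<in> carrier G \<Longrightarrow> h \<in> carrier G \<Longrightarrow> \<alpha> \<in> E \<Longrightarrow> \<beta> \<in> E \<Longrightarrow> v \<in> carrier V \<Longrightarrow>
      lam V (g, \<alpha>) (rho V (h, \<beta>) v) = lam V (g \<otimes>\<^bsub>G\<^esub> h, \<alpha>) v"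
    and "\<And>\<alpha> v. \<alpha> \<in> E \<Longrightarrow> v \<in> carrier V \<Longrightarrow> rho V (\<one>\<^bsub>G\<^esub>, \<alpha>) v = v"
proof -
  have mixed: "lam V (x \<stileturn>\<^bsub>D\<^esub> y) v = lam V x (lam V y v) \<and>
      rho V (x \<turnstile>\<^bsub>D\<^esub> y) v = rho V x (rho V y v) \<and>
      rho V x (lam V y v) = lam V (x \<turnstile>\<^bsub>D\<^esub> y) v \<and>
      lam V x (rho V y v) = lam V (x \<stileturn>\<^bsub>D\<^esub> y) v"
    if "x \<in> carrier D" "y \<in> carrier D" "v \<in> carrier V" for x y v
    using assms that unfolding is_rep_def by blast
  fix g \<alpha> h \<beta> v
  assume "g \<in> carrier G" "h \<in> carrier G" "\<alpha> \<in> E" "\<beta> \<in> E" "v \<in> carrier V"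
  then show "lam V (g, \<alpha>) (lam V (h, \<beta>) v) = lam V (g \<otimes>\<^bsub>G\<^esub> h, \<alpha>) v"
    and "rho V (g, \<alpha>) (rho V (h, \<beta>) v) = rho V (g \<otimes>\<^bsub>G\<^esub> h, \<phi> g \<beta>) v"
    and "rho V (g, \<alpha>) (lam V (h, \<beta>) v) = lam V (g \<otimes>\<^bsub>G\<^esub> h, \<phi> g \<beta>) v"
    and "lam V (g, \<alpha>) (rho V (h, \<beta>) v) = lam V (g \<otimes>\<^bsub>G\<^esub> h, \<alpha>) v"
    using mixed[of "(g, \<alpha>)" "(h, \<beta>)" v] by (auto simp: action_digroup_def)
qed (use assms in \<open>auto simp: is_rep_def action_digroup_def\<close>)

lemma action_inv: "g \<in> carrier G \<Longrightarrow> \<alpha> \<in> E \<Longrightarrow> \<phi> g (\<phi> (inv\<^bsub>G\<^esub> g) \<alpha>) = \<alpha>"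
  using act.orbit_sym_aux[of "inv\<^bsub>G\<^esub> g" \<alpha>] by simp

text \<open>The base points \<open>\<alpha>\<close> and \<open>\<beta>\<close> may differ: the product of the two elements lies in the halo
  anyway.\<close>

lemma rho_inverse:
  assumes "is_rep K D V" "g \<in> carrier G" "\<alpha> \<in> E" "\<beta> \<in> E" "v \<in> carrier V"
  shows "rho V (g, \<alpha>) (rho V (inv\<^bsub>G\<^esub> g, \<beta>) v) = v"
    and "rho V (inv\<^bsub>G\<^esub> g, \<beta>) (rho V (g, \<alpha>) v) = v"
  using assms repD(5,8)[OF assms(1)] act.element_image[OF _ _ refl] by simp_all

lemma rep_halo_module: "is_rep K D V \<Longrightarrow> halo_module K V G E"
  using repD[of V] by (intro halo_module.intro halo_module_axioms.intro) auto

lemma rho_grp_linear: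
  assumes "is_rep K D V" "g \<in> carrier G"
  shows "rho_grp E V g \<in> linear_maps K V V"
  unfolding rho_grp_def using repD(3)[OF assms] nonempty by (simp add: some_in_eq)

lemma rho_grp_inverse:
  assumes "is_rep K D V" "g \<in> carrier G" "v \<in> carrier V"
  shows "rho_grp E V g (rho_grp E V (inv\<^bsub>G\<^esub> g) v) = v"
    and "rho_grp E V (inv\<^bsub>G\<^esub> g) (rho_grp E V g v) = v"
  unfolding rho_grp_def using rho_inverse[OF assms(1,2) _ _ assms(3)] nonempty
  by (simp_all add: some_in_eq)

text \<open>The group permutes the generators of the halo algebra: conjugating by \<open>\<rho>\<^sub>g\<close> translates the
  index. Both sides are the value of \<open>lam\<close> at the same element of the
  digroup.\<close>

lemma rho_grp_lam:
  assumes "is_rep K D V" "g \<in> carrier G" "\<alpha> \<in> E" "v \<in> carrier V"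
  shows "rho_grp E V g (lam V (\<one>\<^bsub>G\<^esub>, \<alpha>) v) = lam V (\<one>\<^bsub>G\<^esub>, \<phi> g \<alpha>) (rho_grp E V g v)"
  unfolding rho_grp_def
  using repD(6,7)[OF assms(1)] assms nonempty act.element_image[of g \<alpha>] by (simp add: some_in_eq)

lemma hom_act_eq:
  assumes Q: "is_rep K D Q" and g: "g \<in> carrier G"
  shows "hom_act E Q W g f = (\<lambda>q\<in>carrier Q. rho_grp E W g (f (rho_grp E Q (inv\<^bsub>G\<^esub> g) q)))"
proof -
  have "inv_into (carrier Q) (rho_grp E Q g) q = rho_grp E Q (inv\<^bsub>G\<^esub> g) q" if q: "q \<in> carrier Q" for q
  proof (rule inv_into_f_eq)
    show "inj_on (rho_grp E Q g) (carrier Q)"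
      by (rule inj_on_inverseI) (rule rho_grp_inverse(2)[OF Q g])
    show "rho_grp E Q (inv\<^bsub>G\<^esub> g) q \<in> carrier Q"
      using linear_mapsD(1)[OF rho_grp_linear[OF Q]] g q by simp
    show "rho_grp E Q g (rho_grp E Q (inv\<^bsub>G\<^esub> g) q) = q"
      by (rule rho_grp_inverse(1)[OF Q g q])
  qed
  then show ?thesis
    unfolding hom_act_def by (intro restrict_ext) simp
qed

lemma hom_act_inverse:
  assumes Q: "is_rep K D Q" and W: "is_rep K D W" and g: "g \<in> carrier G"
    and f: "f \<in> carrier Q \<rightarrow>\<^sub>E carrier W"
  shows "hom_act E Q W g (hom_act E Q W (inv\<^bsub>G\<^esub> g) f) = f"
proof (rule extensionalityI)
  have ig: "inv\<^bsub>G\<^esub> g \<in> carrier G" using g by simp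
  fix q assume q: "q \<in> carrier Q"
  then have "rho_grp E Q (inv\<^bsub>G\<^esub> g) q \<in> carrier Q"
    by (rule linear_mapsD(1)[OF rho_grp_linear[OF Q ig]])
  then show "hom_act E Q W g (hom_act E Q W (inv\<^bsub>G\<^esub> g) f) q = f q"
    using q f g rho_grp_inverse(1)[OF Q g q] rho_grp_inverse(1)[OF W g]
    by (auto simp: hom_act_eq[OF Q g] hom_act_eq[OF Q ig])
qed (use f in \<open>auto simp: hom_act_def PiE_def\<close>)

text \<open>The conjugate commutes with the generator at \<open>\<alpha>\<close> because \<open>f\<close> commutes with the one at the
  translate of \<open>\<alpha>\<close> by the inverse of \<open>g\<close>; the criterion quantifies over all generators.\<close>

lemma hom_act_halo_hom:
  assumes Q: "is_rep K D Q" and W: "is_rep K D W" and g: "g \<in> carrier G"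
    and f: "f \<in> carrier (halo_hom K G E Q W)"
  shows "hom_act E Q W g f \<in> carrier (halo_hom K G E Q W)"
proof -
  note iff = halo_hom_iff[OF rep_halo_module[OF Q] rep_halo_module[OF W]]
  have ig: "inv\<^bsub>G\<^esub> g \<in> carrier G" using g by simp
  interpret Q: halo_module K Q G E by (rule rep_halo_module[OF Q])
  note rQ = rho_grp_linear[OF Q ig] and rW = rho_grp_linear[OF W g]
  let ?f = "\<lambda>q. rho_grp E W g (f (rho_grp E Q (inv\<^bsub>G\<^esub> g) q))"
  have lin: "f \<in> linear_maps K Q W"
    and lam: "\<And>\<alpha> v. \<alpha> \<in> E \<Longrightarrow> v \<in> carrier Q \<Longrightarrow> f (lam Q (\<one>\<^bsub>G\<^esub>, \<alpha>) v) = lam W (\<one>\<^bsub>G\<^esub>, \<alpha>) (f v)"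
    using f by (auto simp: iff)
  have f_lin: "?f \<in> linear_maps K Q W"
    by (rule linear_maps_comp[OF linear_maps_comp[OF rQ lin] rW])
  have f_lam: "?f (lam Q (\<one>\<^bsub>G\<^esub>, \<alpha>) q) = lam W (\<one>\<^bsub>G\<^esub>, \<alpha>) (?f q)"
    if \<alpha>: "\<alpha> \<in> E" and q: "q \<in> carrier Q" for \<alpha> q
  proof -
    have \<beta>: "\<phi> (inv\<^bsub>G\<^esub> g) \<alpha> \<in> E"
      using act.element_image[OF ig \<alpha>] by simp
    have r: "rho_grp E Q (inv\<^bsub>G\<^esub> g) q \<in> carrier Q"
      by (rule linear_mapsD(1)[OF rQ q])
    show ?thesis
      using rho_grp_lam[OF Q ig \<alpha> q] rho_grp_lam[OF W g \<beta> linear_mapsD(1)[OF lin r]]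
        lam[OF \<beta> r] action_inv[OF g \<alpha>] by simp
  qed
  have "lam Q (\<one>\<^bsub>G\<^esub>, \<alpha>) q \<in> carrier Q" if "\<alpha> \<in> E" "q \<in> carrier Q" for \<alpha> q
    using that by (rule linear_mapsD(1)[OF Q.lam_linear])
  then show ?thesis
    using f_lin f_lam by (auto simp: iff hom_act_eq[OF Q g] linear_maps_def)
qed

section \<open>Splitting the injective resolution\<close>

text \<open>The kernel is taken as a subset of the carrier, so that it stays in the same universe and can be used
  in a short exact sequence there. Bijectivity of \<open>\<rho>\<close> on it holds because the inverse operator is
  again some \<open>\<rho>\<close> and thus preserves the kernel too.\<close>

lemma kernel_rep:
  assumes V: "is_rep K D V" and W: "is_rep K D W" and f: "f \<in> rep_morphisms K D V W"
  shows "is_rep K D (V\<lparr>carrier := {v \<in> carrier V. f v = \<zero>\<^bsub>W\<^esub>}\<rparr>)" (is "is_rep K D ?Z")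
proof -
  interpret V: module K V by (rule repD(1)[OF V])
  interpret W: module K W by (rule repD(1)[OF W])
  let ?N = "{v \<in> carrier V. f v = \<zero>\<^bsub>W\<^esub>}"
  have lin: "f \<in> linear_maps K V W"
    and flam: "\<And>g \<alpha> v. g \<in> carrier G \<Longrightarrow> \<alpha> \<in> E \<Longrightarrow> v \<in> carrier V \<Longrightarrow> f (lam V (g, \<alpha>) v) = lam W (g, \<alpha>) (f v)"
    and frho: "\<And>g \<alpha> v. g \<in> carrier G \<Longrightarrow> \<alpha> \<in> E \<Longrightarrow> v \<in> carrier V \<Longrightarrow> f (rho V (g, \<alpha>) v) = rho W (g, \<alpha>) (f v)"
    using f by (auto simp: rep_morphisms_def action_digroup_def)
  have f0: "f \<zero>\<^bsub>V\<^esub> = \<zero>\<^bsub>W\<^esub>"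
    by (rule linear_map_zero[OF V.module_axioms W.module_axioms lin])
  have fm: "f (\<ominus>\<^bsub>V\<^esub> v) = \<zero>\<^bsub>W\<^esub>" if "v \<in> ?N" for v
    using that linear_mapsD(2)[OF lin, of "\<ominus>\<^bsub>V\<^esub> v" v] linear_mapsD(1)[OF lin, of "\<ominus>\<^bsub>V\<^esub> v"]
    by (simp add: V.M.l_neg f0)
  have "submodule ?N K V"
    by (rule V.submoduleI) (use f0 fm in \<open>auto simp: linear_mapsD(2,3)[OF lin]\<close>)
  then have mod: "module K ?Z"
    by (rule submodule.submodule_is_module[OF _ V.module_axioms])
  have lamN: "lam V (g, \<alpha>) v \<in> ?N" if "g \<in> carrier G" "\<alpha> \<in> E" "v \<in> ?N" for g \<alpha> v
    using that linear_mapsD(1)[OF repD(2)[OF V that(1,2)]]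
      linear_map_zero[OF W.module_axioms W.module_axioms repD(2)[OF W that(1,2)]]
    by (simp add: flam)
  have rhoN: "rho V (g, \<alpha>) v \<in> ?N" if "g \<in> carrier G" "\<alpha> \<in> E" "v \<in> ?N" for g \<alpha> v
    using that linear_mapsD(1)[OF repD(3)[OF V that(1,2)]]
      linear_map_zero[OF W.module_axioms W.module_axioms repD(3)[OF W that(1,2)]]
    by (simp add: frho)
  have lin_N: "h \<in> linear_maps K ?Z ?Z" if "h \<in> linear_maps K V V" "\<And>v. v \<in> ?N \<Longrightarrow> h v \<in> ?N" for h
    using that by (auto simp: linear_maps_def)
  have lin_lam: "lam ?Z (g, \<alpha>) \<in> linear_maps K ?Z ?Z" if "g \<in> carrier G" "\<alpha> \<in> E" for g \<alpha>
    using lin_N[OF repD(2)[OF V that] lamN[OF that]] by simp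
  have lin_rho: "rho ?Z (g, \<alpha>) \<in> linear_maps K ?Z ?Z" if "g \<in> carrier G" "\<alpha> \<in> E" for g \<alpha>
    using lin_N[OF repD(3)[OF V that] rhoN[OF that]] by simp
  have bij: "bij_betw (rho V (g, \<alpha>)) ?N ?N" if "g \<in> carrier G" "\<alpha> \<in> E" for g \<alpha>
    by (rule bij_betw_byWitness[where f' = "rho V (inv\<^bsub>G\<^esub> g, \<alpha>)"])
      (use that rhoN rho_inverse[OF V that that(2)] in auto)
  show ?thesis
    unfolding is_rep_def
    using mod lin_lam lin_rho bij repD(4-8)[OF V]
    by (auto simp: action_digroup_def)
qed

text \<open>The cocycle \<open>f\<close> takes values in \<open>Z = ker d\<^sup>1 = im d\<^sup>0\<close>, and the sequence
  \<open>0 \<rightarrow> W \<rightarrow> I\<^sup>0 \<rightarrow> Z \<rightarrow> 0\<close> is exact. A section \<open>s\<close> of \<open>d\<^sup>0\<close> exhibits \<open>f\<close> as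
  the coboundary of \<open>s \<circ> f\<close>.\<close>

lemma cocycle_is_coboundary:
  fixes W :: "('k, 'v, 'g \<times> 'e) rep"
  assumes ss: "semisimple_Rep K D TYPE('v)"
    and Q: "is_rep K D Q" and res: "injective_resolution K D W \<eta> I d"
    and f: "f \<in> Ext1_cocycles K G E Q I d"
  shows "f \<in> Ext1_coboundaries K G E Q I d"
proof -
  have W: "is_rep K D W" and I: "\<And>n. is_rep K D (I n)"
    and \<eta>: "\<eta> \<in> rep_morphisms K D W (I 0)" "inj_on \<eta> (carrier W)" "exact_at W \<eta> (I 0) (d 0) (I 1)"
    and d: "\<And>n. d n \<in> rep_morphisms K D (I n) (I (Suc n))"
    and ex: "exact_at (I 0) (d 0) (I 1) (d 1) (I 2)"
    using res by (auto simp: injective_resolution_def injective_rep_def numeral_2_eq_2)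
  define Z where "Z = I 1\<lparr>carrier := {z \<in> carrier (I 1). d 1 z = \<zero>\<^bsub>I 2\<^esub>}\<rparr>"
  have Z: "is_rep K D Z"
    unfolding Z_def using kernel_rep[OF I I d[of 1]] by (simp add: numeral_2_eq_2)
  have im: "d 0 ` carrier (I 0) = carrier Z"
    using ex by (simp add: exact_at_def Z_def)
  have d0: "d 0 \<in> rep_morphisms K D (I 0) Z"
    using d[of 0] im by (auto simp: rep_morphisms_def linear_maps_def Z_def)
  have "short_exact K D W \<eta> (I 0) (d 0) Z"
    using W I Z \<eta> d0 im by (simp add: short_exact_def exact_at_def Z_def)
  then obtain s where s: "s \<in> rep_morphisms K D Z (I 0)" "\<And>z. z \<in> carrier Z \<Longrightarrow> d 0 (s z) = z"
    using ss unfolding semisimple_Rep_def by blast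
  note iff = halo_hom_iff[OF rep_halo_module[OF Q] rep_halo_module[OF I]]
  interpret Q: halo_module K Q G E by (rule rep_halo_module[OF Q])
  have f_hom: "f \<in> carrier (halo_hom K G E Q (I 1))" and fZ: "\<And>q. q \<in> carrier Q \<Longrightarrow> f q \<in> carrier Z"
    using f linear_mapsD(1)[of f K Q "I 1"] by (auto simp: Ext1_cocycles_def Z_def iff)
  have f_lin: "f \<in> linear_maps K Q Z"
    using f_hom fZ by (auto simp: iff linear_maps_def Z_def)
  have sf_lin: "(\<lambda>q. s (f q)) \<in> linear_maps K Q (I 0)"
    using s(1) by (intro linear_maps_comp[OF f_lin]) (simp add: rep_morphisms_def)
  have sf_lam: "s (f (lam Q (\<one>\<^bsub>G\<^esub>, \<alpha>) q)) = lam (I 0) (\<one>\<^bsub>G\<^esub>, \<alpha>) (s (f q))"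
    if "\<alpha> \<in> E" "q \<in> carrier Q" for \<alpha> q
  proof -
    have "f (lam Q (\<one>\<^bsub>G\<^esub>, \<alpha>) q) = lam Z (\<one>\<^bsub>G\<^esub>, \<alpha>) (f q)"
      using f_hom that by (simp add: iff Z_def)
    then show ?thesis
      using s(1) fZ[OF that(2)] that by (simp add: rep_morphisms_def action_digroup_def)
  qed
  have lamQ: "lam Q (\<one>\<^bsub>G\<^esub>, \<alpha>) q \<in> carrier Q" if "\<alpha> \<in> E" "q \<in> carrier Q" for \<alpha> q
    using that by (rule linear_mapsD(1)[OF Q.lam_linear])
  have "(\<lambda>q\<in>carrier Q. s (f q)) \<in> carrier (halo_hom K G E Q (I 0))"
    using sf_lin sf_lam lamQ by (auto simp: iff linear_maps_def)
  moreover have "f = (\<lambda>q\<in>carrier Q. d 0 ((\<lambda>q\<in>carrier Q. s (f q)) q))"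
    by (rule extensionalityI[of _ "carrier Q"]) (use f_hom fZ s(2) in \<open>auto simp: iff\<close>)
  ultimately show ?thesis
    unfolding Ext1_coboundaries_def by blast
qed

lemma coboundary_is_cocycle:
  assumes Q: "is_rep K D Q" and res: "injective_resolution K D W \<eta> I d"
    and f: "f \<in> Ext1_coboundaries K G E Q I d"
  shows "f \<in> Ext1_cocycles K G E Q I d"
proof -
  have I: "\<And>n. is_rep K D (I n)"
    and d: "d 0 \<in> rep_morphisms K D (I 0) (I 1)"
    and ex: "exact_at (I 0) (d 0) (I 1) (d 1) (I 2)"
    using res by (auto simp: injective_resolution_def injective_rep_def numeral_2_eq_2)
  note iff = halo_hom_iff[OF rep_halo_module[OF Q] rep_halo_module[OF I]]
  interpret Q: halo_module K Q G E by (rule rep_halo_module[OF Q])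
  obtain h where h: "h \<in> carrier (halo_hom K G E Q (I 0))" and f_eq: "f = (\<lambda>q\<in>carrier Q. d 0 (h q))"
    using f by (auto simp: Ext1_coboundaries_def)
  have h_closed: "h q \<in> carrier (I 0)" if "q \<in> carrier Q" for q
    using h that linear_mapsD(1)[of h K Q "I 0"] by (simp add: iff)
  have "(\<lambda>q. d 0 (h q)) \<in> linear_maps K Q (I 1)"
    using h d linear_maps_comp[of h K Q "I 0" "d 0" "I 1"] by (simp add: iff rep_morphisms_def)
  moreover have "d 0 (h (lam Q (\<one>\<^bsub>G\<^esub>, \<alpha>) q)) = lam (I 1) (\<one>\<^bsub>G\<^esub>, \<alpha>) (d 0 (h q))"
    if "\<alpha> \<in> E" "q \<in> carrier Q" for \<alpha> q
    using h d that h_closed by (simp add: iff rep_morphisms_def action_digroup_def)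
  moreover have "lam Q (\<one>\<^bsub>G\<^esub>, \<alpha>) q \<in> carrier Q" if "\<alpha> \<in> E" "q \<in> carrier Q" for \<alpha> q
    using that by (rule linear_mapsD(1)[OF Q.lam_linear])
  ultimately have "f \<in> carrier (halo_hom K G E Q (I 1))"
    unfolding f_eq by (auto simp: iff linear_maps_def)
  moreover have "d 1 (f q) = \<zero>\<^bsub>I 2\<^esub>" if "q \<in> carrier Q" for q
    using ex h_closed[OF that] that unfolding exact_at_def f_eq by auto
  ultimately show ?thesis
    by (simp add: Ext1_cocycles_def)
qed

lemma hom_act_cocycles:
  assumes Q: "is_rep K D Q" and res: "injective_resolution K D W \<eta> I d" and g: "g \<in> carrier G"
  shows "hom_act E Q (I 1) g ` Ext1_cocycles K G E Q I d = Ext1_cocycles K G E Q I d"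
proof -
  have I: "\<And>n. is_rep K D (I n)"
    and d: "d 1 \<in> rep_morphisms K D (I 1) (I 2)"
    using res by (auto simp: injective_resolution_def injective_rep_def numeral_2_eq_2)
  have maps: "hom_act E Q (I 1) h f \<in> Ext1_cocycles K G E Q I d"
    if h: "h \<in> carrier G" and f: "f \<in> Ext1_cocycles K G E Q I d" for h f
  proof -
    have f_hom: "f \<in> carrier (halo_hom K G E Q (I 1))"
      and f0: "\<And>q. q \<in> carrier Q \<Longrightarrow> d 1 (f q) = \<zero>\<^bsub>I 2\<^esub>"
      using f by (auto simp: Ext1_cocycles_def)
    have "d 1 (hom_act E Q (I 1) h f q) = \<zero>\<^bsub>I 2\<^esub>" if q: "q \<in> carrier Q" for q
    proof -
      let ?q = "rho_grp E Q (inv\<^bsub>G\<^esub> h) q"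
      have q': "?q \<in> carrier Q"
        using h q by (intro linear_mapsD(1)[OF rho_grp_linear[OF Q]]) auto
      have fq: "f ?q \<in> carrier (I 1)"
        using f_hom q' by (auto simp: halo_hom_def)
      have "d 1 (rho_grp E (I 1) h (f ?q)) = rho_grp E (I 2) h (d 1 (f ?q))"
        using d h fq nonempty
        by (simp add: rho_grp_def rep_morphisms_def action_digroup_def some_in_eq)
      also have "\<dots> = \<zero>\<^bsub>I 2\<^esub>"
        using f0[OF q'] linear_map_zero[OF repD(1)[OF I] repD(1)[OF I] rho_grp_linear[OF I h]]
        by simp
      finally show ?thesis
        using q by (simp add: hom_act_eq[OF Q h])
    qed
    then show ?thesis
      using hom_act_halo_hom[OF Q I h f_hom] by (simp add: Ext1_cocycles_def)
  qed
  moreover have "f \<in> hom_act E Q (I 1) g ` Ext1_cocycles K G E Q I d"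
    if f: "f \<in> Ext1_cocycles K G E Q I d" for f
  proof (rule image_eqI)
    show "f = hom_act E Q (I 1) g (hom_act E Q (I 1) (inv\<^bsub>G\<^esub> g) f)"
      using f by (intro hom_act_inverse[OF Q I g, symmetric]) (simp add: Ext1_cocycles_def halo_hom_def)
  qed (use g f maps in auto)
  ultimately show ?thesis using g by blast
qed

lemma cocycles_subgroup:
  assumes Q: "is_rep K D Q" and res: "injective_resolution K D W \<eta> I d"
  shows "subgroup (Ext1_cocycles K G E Q I d) (halo_hom K G E Q (I 1))"
proof -
  have I: "\<And>n. is_rep K D (I n)" and d: "d 1 \<in> linear_maps K (I 1) (I 2)"
    using res by (auto simp: injective_resolution_def injective_rep_def numeral_2_eq_2 rep_morphisms_def)
  interpret H: group "halo_hom K G E Q (I 1)"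
    by (rule halo_module.halo_hom_group[OF rep_halo_module[OF Q] rep_halo_module[OF I]])
  interpret I1: module K "I 1" by (rule repD(1)[OF I])
  interpret I2: module K "I 2" by (rule repD(1)[OF I])
  let ?H = "halo_hom K G E Q (I 1)" and ?C = "Ext1_cocycles K G E Q I d"
  have closed: "f q \<in> carrier (I 1)" if "f \<in> carrier ?H" "q \<in> carrier Q" for f q
    using that by (auto simp: halo_hom_def)
  have mult: "(f \<otimes>\<^bsub>?H\<^esub> h) q = f q \<oplus>\<^bsub>I 1\<^esub> h q" if "q \<in> carrier Q" for f h q
    using that by (simp add: halo_hom_def)
  have one: "\<one>\<^bsub>?H\<^esub> q = \<zero>\<^bsub>I 1\<^esub>" if "q \<in> carrier Q" for q
    using that by (simp add: halo_hom_def)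
  \<comment> \<open>The simplifier would rewrite the index of \<open>I 1\<close> to \<open>Suc 0\<close> and then miss the facts above.\<close>
  note One_nat_def [simp del]
  have d0: "d 1 \<zero>\<^bsub>I 1\<^esub> = \<zero>\<^bsub>I 2\<^esub>"
    by (rule linear_map_zero[OF I1.module_axioms I2.module_axioms d])
  show ?thesis
  proof (rule H.subgroupI)
    show "?C \<subseteq> carrier ?H"
      by (auto simp: Ext1_cocycles_def)
    have "\<one>\<^bsub>?H\<^esub> \<in> ?C"
      using H.one_closed one d0 by (simp add: Ext1_cocycles_def)
    then show "?C \<noteq> {}" by blast
    show "f \<otimes>\<^bsub>?H\<^esub> h \<in> ?C" if "f \<in> ?C" "h \<in> ?C" for f h
      using that closed[of f] closed[of h]
      by (simp add: Ext1_cocycles_def mult linear_mapsD(2)[OF d])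
    show "inv\<^bsub>?H\<^esub> f \<in> ?C" if f: "f \<in> ?C" for f
    proof -
      let ?f = "inv\<^bsub>?H\<^esub> f"
      have fc: "f \<in> carrier ?H" and f0: "\<And>q. q \<in> carrier Q \<Longrightarrow> d 1 (f q) = \<zero>\<^bsub>I 2\<^esub>"
        using f by (auto simp: Ext1_cocycles_def)
      have "d 1 (?f q) = \<zero>\<^bsub>I 2\<^esub>" if q: "q \<in> carrier Q" for q
      proof -
        have "?f q \<oplus>\<^bsub>I 1\<^esub> f q = \<zero>\<^bsub>I 1\<^esub>"
          using H.l_inv[OF fc] mult[OF q, of ?f f] one[OF q] by simp
        then have "d 1 (?f q) \<oplus>\<^bsub>I 2\<^esub> d 1 (f q) = \<zero>\<^bsub>I 2\<^esub>"
          using d0 linear_mapsD(2)[OF d closed closed, of ?f q f q] fc q by simp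
        then show ?thesis
          using f0[OF q] linear_mapsD(1)[OF d closed, of ?f q] fc q by simp
      qed
      then show ?thesis using fc by (simp add: Ext1_cocycles_def)
    qed
  qed
qed

text \<open>The only class is that of the coboundaries, which is the whole set of cocycles. It is invariant because
  the cocycles are stable under the group; without this the set of invariants would be empty
  and not the trivial group.\<close>

lemma Ext1_invariants_semisimple:
  fixes W :: "('k, 'v, 'g \<times> 'e) rep"
  assumes ss: "semisimple_Rep K D TYPE('v)"
    and Q: "is_rep K D Q" and res: "injective_resolution K D W \<eta> I d"
  shows "Ext1_invariants K G E Q I d = {\<one>\<^bsub>Ext1 K G E Q I d\<^esub>}"
proof -
  let ?C = "Ext1_cocycles K G E Q I d"
  let ?Z = "halo_hom K G E Q (I 1)\<lparr>carrier := ?C\<rparr>"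
  have eq: "Ext1_coboundaries K G E Q I d = ?C"
    using cocycle_is_coboundary[OF ss Q res] coboundary_is_cocycle[OF Q res] by blast
  have I: "is_rep K D (I 1)"
    using res by (simp add: injective_resolution_def injective_rep_def)
  interpret Z: group ?Z
    by (rule subgroup.subgroup_is_group[OF cocycles_subgroup[OF Q res]
          halo_module.halo_hom_group[OF rep_halo_module[OF Q] rep_halo_module[OF I]]])
  have "?C #>\<^bsub>?Z\<^esub> f = ?C" if "f \<in> ?C" for f
    using Z.coset_join2[OF _ Z.subgroup_self] that by simp
  moreover have "?C \<noteq> {}" using Z.one_closed by auto
  ultimately have "carrier (Ext1 K G E Q I d) = {?C}"
    by (auto simp: Ext1_def eq FactGroup_def RCOSETS_def)
  moreover have "\<one>\<^bsub>Ext1 K G E Q I d\<^esub> = ?C"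
    by (simp add: Ext1_def eq FactGroup_def)
  ultimately show ?thesis
    using hom_act_cocycles[OF Q res]
    by (simp add: Ext1_invariants_def del: One_nat_def cong: conj_cong)
qed

end

theorem corollary62:
  fixes K :: "('k, 'm) ring_scheme"
    and G :: "('g, 'n) monoid_scheme"
    and E :: "'e set"
    and \<phi> :: "'g \<Rightarrow> 'e \<Rightarrow> 'e"
  assumes "field K"
    and "\<And>n::nat. 0 < n \<Longrightarrow> [n] \<cdot>\<^bsub>K\<^esub> \<one>\<^bsub>K\<^esub> \<noteq> \<zero>\<^bsub>K\<^esub>"
    and "group G" and "finite (carrier G)"
    and "group_action G E \<phi>" and "E \<noteq> {}"
    and "\<exists>(Q :: ('k, 'v, 'g \<times> 'e) rep) W \<eta> I d.
      is_rep K (action_digroup G E \<phi>) Q \<and> is_rep K (action_digroup G E \<phi>) W \<and>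
      injective_resolution K (action_digroup G E \<phi>) W \<eta> I d \<and>
      Ext1_invariants K G E Q I d \<noteq> {\<one>\<^bsub>Ext1 K G E Q I d\<^esub>}"
  shows "\<not> semisimple_Rep K (action_digroup G E \<phi>) TYPE('v)"
proof
  assume ss: "semisimple_Rep K (action_digroup G E \<phi>) TYPE('v)"
  interpret field K by fact
  interpret group_action G E \<phi> by fact
  interpret digroup_action K G E \<phi>
    by unfold_locales (fact \<open>E \<noteq> {}\<close>)
  from assms(7) Ext1_invariants_semisimple[OF ss] show False
    by blast
qed

end
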